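(* Let $\{p_k\}_{k\in\Gamma}$ be a finitely supported family of real numbers with $\sum_{k\in\Gamma}p_k=1$ satisfying the orthonormality conditions $$\sum_{k\in\Gamma}p_k\,p_{k+Mi}=\begin{cases}\tfrac12 & \text{if } i=0,\\ 0 & \text{if } i\neq0,\end{cases}\qquad\text{for all } i\in\Gamma.$$ Let $\mu$ be the weak limit of the associated sequence $(\mu_n)_{n\ge1}$ defined in the context (this limit exists under these hypotheses). Then $\mu$ has a density $\phi$ with respect to Lebesgue measure on $\mathbb{R}^m$, and $\phi\in L^2(\mathbb{R}^m)$ with $\|\phi\|_2\le 1$.
   Context: Two cases are treated simultaneously. Either $m=1$, $\Gamma=\mathbb{Z}\subset\mathbb{R}$ and $M$ is multiplication by $2$ on $\mathbb{R}$; or $m=2$, $\Gamma=\mathbb{Z}^2\subset\mathbb{R}^2$, where $\mathbb{R}^2$ is identified with $\mathbb{C}$ (so $\Gamma$ is the Gaussian integers), and $M$ is multiplication by the complex number $1+\sqrt{-1}$. (In the orthonormality conditions, $i$ denotes an index in $\Gamma$, not the imaginary unit.) Let $\delta_x$ be the unit point mass at $x$, let $D(x)=M^{-1}x$, and let $D_\star$ be the push-forward by $D$ on finite signed Borel measures on $\mathbb{R}^m$. Define $\mu_1=\sum_{k\in\Gamma}p_k\,\delta_{M^{-1}k}$ and, for $n\ge2$, $\mu_n=\mu_1\star D_\star(\mu_{n-1})$, where $\star$ is convolution. Weak convergence $\nu_n\to\nu$ of finite signed measures means $\int f\,d\nu_n\to\int f\,d\nu$ for every bounded continuous real function $f$ on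 $\mathbb{R}^m$. *)

theory Defs
  imports "HOL-Analysis.Analysis"
begin

text \<open>
  A finite signed Borel measure is represented by a set function, of which only the values on
  Borel sets are relevant.  Absolute convergence of the series below is automatic, since the
  union does not depend on the order of the sets.
\<close>

definition finite_signed_measure :: "('a::topological_space set \<Rightarrow> real) \<Rightarrow> bool" where
  "finite_signed_measure \<nu> \<longleftrightarrow>
     \<nu> {} = 0 \<and>
     (\<forall>A::nat \<Rightarrow> 'a set. range A \<subseteq> sets borel \<longrightarrow> disjoint_family A \<longrightarrow>
        (\<lambda>i. \<nu> (A i)) sums \<nu> (\<Union>i. A i))"

text \<open>
  The upper variation of \<open>\<nu>\<close>, i.e. the positive part of its Jordan decomposition; the negative
  part is the upper variation of \<open>-\<nu>\<close>.  As \<^term>\<open>ennreal\<close> maps negative numbers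
  to \<open>0\<close>, this is the supremum of the nonnegative values \<open>\<nu> B\<close> with \<open>B \<subseteq> A\<close>.
\<close>

definition upper_variation :: "('a::topological_space set \<Rightarrow> real) \<Rightarrow> 'a measure" where
  "upper_variation \<nu> =
     measure_of UNIV (sets borel) (\<lambda>A. SUP B\<in>{B \<in> sets borel. B \<subseteq> A}. ennreal (\<nu> B))"

definition signed_integral :: "('a::topological_space set \<Rightarrow> real) \<Rightarrow> ('a \<Rightarrow> real) \<Rightarrow> real" where
  "signed_integral \<nu> f =
     integral\<^sup>L (upper_variation \<nu>) f - integral\<^sup>L (upper_variation (\<lambda>A. - \<nu> A)) f"

definition dirac :: "'a \<Rightarrow> 'a set \<Rightarrow> real" where
  "dirac x A = indicator A x"

definition push_forward :: "('a \<Rightarrow> 'b) \<Rightarrow> ('a set \<Rightarrow> real) \<Rightarrow> 'b set \<Rightarrow> real" where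
  "push_forward T \<nu> A = \<nu> (T -` A)"

definition signed_convolution ::
  "('a::{topological_space, plus} set \<Rightarrow> real) \<Rightarrow> ('a set \<Rightarrow> real) \<Rightarrow> 'a set \<Rightarrow> real" where
  "signed_convolution \<alpha> \<beta> A = signed_integral \<alpha> (\<lambda>x. \<beta> {y. x + y \<in> A})"

definition weak_limit ::
  "(nat \<Rightarrow> 'a::topological_space set \<Rightarrow> real) \<Rightarrow> ('a set \<Rightarrow> real) \<Rightarrow> bool" where
  "weak_limit \<nu>s \<nu> \<longleftrightarrow>
     (\<forall>f. continuous_on UNIV f \<longrightarrow> bounded (range f) \<longrightarrow>
        (\<lambda>n. signed_integral (\<nu>s n) f) \<longlonglongrightarrow> signed_integral \<nu> f)"


definition signed_density :: "('a::euclidean_space set \<Rightarrow> real) \<Rightarrow> ('a \<Rightarrow> real) \<Rightarrow> bool" where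
  "signed_density \<nu> \<phi> \<longleftrightarrow>
     integrable lborel \<phi> \<and> (\<forall>A\<in>sets borel. \<nu> A = (LINT x:A|lborel. \<phi> x))"

definition square_integrable :: "('a::euclidean_space \<Rightarrow> real) \<Rightarrow> bool" where
  "square_integrable \<phi> \<longleftrightarrow>
     \<phi> \<in> borel_measurable lborel \<and> integrable lborel (\<lambda>x. (\<phi> x)\<^sup>2)"

definition L2_norm :: "('a::euclidean_space \<Rightarrow> real) \<Rightarrow> real" where
  "L2_norm \<phi> = sqrt (LINT x|lborel. (\<phi> x)\<^sup>2)"


text \<open>
  The one- and two-dimensional cases are both instances of a lattice \<open>\<Gamma>\<close> in a normed field
  (\<^typ>\<open>real\<close> or \<^typ>\<open>complex\<close>, the latter being the plane), with the dilation
  being multiplication by a field element \<open>m\<close>.  A family indexed by \<open>\<Gamma>\<close> is a function on the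
  whole field of which only the values on \<open>\<Gamma>\<close> are used.
\<close>

definition gaussian_integers :: "complex set" where
  "gaussian_integers = {z. Re z \<in> \<int> \<and> Im z \<in> \<int>}"

definition supp_on :: "'a set \<Rightarrow> ('a \<Rightarrow> real) \<Rightarrow> 'a set" where
  "supp_on \<Gamma> p = {k \<in> \<Gamma>. p k \<noteq> 0}"

definition orthonormality :: "'a::real_normed_field set \<Rightarrow> 'a \<Rightarrow> ('a \<Rightarrow> real) \<Rightarrow> bool" where
  "orthonormality \<Gamma> m p \<longleftrightarrow>
     (\<forall>i\<in>\<Gamma>. (\<Sum>k\<in>supp_on \<Gamma> p. p k * p (k + m * i)) = (if i = 0 then 1 / 2 else 0))"

definition mu_one :: "'a::real_normed_field set \<Rightarrow> 'a \<Rightarrow> ('a \<Rightarrow> real) \<Rightarrow> 'a set \<Rightarrow> real" where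
  "mu_one \<Gamma> m p A = (\<Sum>k\<in>supp_on \<Gamma> p. p k * dirac (k / m) A)"

text \<open>The sequence starts at index \<open>1\<close>; the value at \<open>0\<close> is a dummy.\<close>

fun mu_seq :: "'a::real_normed_field set \<Rightarrow> 'a \<Rightarrow> ('a \<Rightarrow> real) \<Rightarrow> nat \<Rightarrow> 'a set \<Rightarrow> real" where
  "mu_seq \<Gamma> m p 0 = (\<lambda>A. 0)"
| "mu_seq \<Gamma> m p (Suc 0) = mu_one \<Gamma> m p"
| "mu_seq \<Gamma> m p (Suc (Suc n)) =
     signed_convolution (mu_one \<Gamma> m p) (push_forward (\<lambda>x. x / m) (mu_seq \<Gamma> m p (Suc n)))"

end

theory Submission imports Defs begin

text \<open>
  Let \<open>c\<^sub>n(k)\<close> be the mass of \<open>\<mu>\<^sub>n\<close> at \<open>m\<^bsup>-n\<^esup> k\<close>.  Orthonormality makes each refinement step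
  \<open>c\<^sub>n \<mapsto> c\<^bsub>n+1\<^esub>\<close> equal to \<open>1/\<surd>2\<close> times an isometry of \<open>\<ell>\<^sup>2(\<Gamma>)\<close>.  Hence
  \<open>(\<integral>f d\<mu>\<^sub>n)\<^sup>2 \<le> 2\<^bsup>-n\<^esup> \<Sum>\<^sub>k f(m\<^bsup>-n\<^esup> k)\<^sup>2\<close>, and for continuous \<open>f\<close> of compact support the right-hand side is
  a Riemann sum.  In the limit \<open>(\<integral>f d\<mu>)\<^sup>2 \<le> \<integral>f\<^sup>2\<close>.  Testing this against functions
  decreasing to the indicator of a compact null set shows that \<open>\<mu>\<close> is absolutely continuous, and
  testing it against approximations of truncations of the density bounds the \<open>L\<^sup>2\<close> norm by \<open>1\<close>.
\<close>

section \<open>Hahn and Jordan decompositions\<close>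

lemma finite_signed_measure_sums:
  assumes "finite_signed_measure \<nu>" "\<And>i::nat. A i \<in> sets borel" "disjoint_family A"
  shows "(\<lambda>i. \<nu> (A i)) sums \<nu> (\<Union>i. A i)"
  using assms unfolding finite_signed_measure_def by (metis image_subset_iff)

lemma finite_signed_measure_empty: "finite_signed_measure \<nu> \<Longrightarrow> \<nu> {} = 0"
  by (simp add: finite_signed_measure_def)

lemma finite_signed_measure_uminus:
  "finite_signed_measure \<nu> \<Longrightarrow> finite_signed_measure (\<lambda>A. - \<nu> A)"
  by (auto simp: finite_signed_measure_def intro: sums_minus)

lemma finite_signed_measure_Un:
  assumes \<nu>: "finite_signed_measure \<nu>" and AB: "A \<in> sets borel" "B \<in> sets borel" "A \<inter> B = {}"
  shows "\<nu> (A \<union> B) = \<nu> A + \<nu> B"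
proof -
  have "(\<lambda>i. \<nu> (binaryset A B i)) sums \<nu> (\<Union>i. binaryset A B i)"
    using AB by (intro finite_signed_measure_sums[OF \<nu>])
      (auto simp: binaryset_def disjoint_family_on_def)
  moreover have "(\<lambda>i. \<nu> (binaryset A B i)) sums (\<nu> A + \<nu> B)"
    using \<nu> by (intro binaryset_sums) (simp add: finite_signed_measure_empty)
  ultimately show ?thesis
    by (simp add: UN_binaryset_eq sums_unique2)
qed

lemma finite_signed_measure_Diff:
  assumes "finite_signed_measure \<nu>" "A \<in> sets borel" "B \<in> sets borel" "B \<subseteq> A"
  shows "\<nu> (A - B) = \<nu> A - \<nu> B"
  using finite_signed_measure_Un[of \<nu> B "A - B"] assms by (simp add: Un_absorb1)

lemma finite_signed_measure_split:
  assumes "finite_signed_measure \<nu>" "A \<in> sets borel" "B \<in> sets borel"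
  shows "\<nu> A = \<nu> (A \<inter> B) + \<nu> (A - B)"
  using finite_signed_measure_Un[of \<nu> "A \<inter> B" "A - B"] assms by (auto simp: Int_Diff_Un)

text \<open>If some value is at most -1, such a point serves; this covers an infimum of minus
  infinity. Otherwise the infimum s is finite and nonpositive: for s < 0 some value lies below s /
  2, and for s = 0 the point \<open>x0\<close> is a minimum.\<close>

lemma ex_nearly_minimal:
  fixes f :: "'b \<Rightarrow> real"
  assumes "x0 \<in> X" "f x0 = 0"
  shows "\<exists>x\<in>X. \<forall>y\<in>X. f x \<le> max (f y / 2) (-1)"
proof (cases "\<exists>x\<in>X. f x \<le> -1")
  case True
  then show ?thesis by (meson max.coboundedI2)
next
  case False
  then have lb: "\<And>x. x \<in> X \<Longrightarrow> -1 \<le> f x" by force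
  then have bdd: "bdd_below (f ` X)" by (intro bdd_belowI2[of _ "-1"])
  define s where "s = Inf (f ` X)"
  have s: "\<And>y. y \<in> X \<Longrightarrow> s \<le> f y" unfolding s_def using bdd by (auto intro: cInf_lower)
  show ?thesis
  proof (cases "s = 0")
    case True
    then have "\<And>y. y \<in> X \<Longrightarrow> 0 \<le> f y" using s by simp
    then show ?thesis using assms by (intro bexI[of _ x0]) (auto intro!: max.coboundedI1)
  next
    case False
    then have "s < s / 2" using s[OF assms(1)] assms(2) by linarith
    then obtain x where "x \<in> X" "f x < s / 2"
      unfolding s_def using assms(1) by (subst (asm) cInf_less_iff) (use bdd in auto)
    moreover have "s / 2 \<le> f y / 2" if "y \<in> X" for y using s[OF that] by simp
    ultimately show ?thesis
      by (intro bexI[of _ x] ballI max.coboundedI1) (auto intro: less_imp_le order_trans)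
  qed
qed

text \<open>
  Greedy removal of disjoint sets from \<open>A\<close>, at each step of nearly minimal measure among those
  satisfying \<open>Q\<close>; their measures tend to \<open>0\<close>, so nothing negative remains.
\<close>

definition exhausts ::
    "('a::topological_space set \<Rightarrow> real) \<Rightarrow> ('a set \<Rightarrow> bool) \<Rightarrow> 'a set \<Rightarrow> (nat \<Rightarrow> 'a set) \<Rightarrow> bool" where
  "exhausts \<nu> Q A E \<longleftrightarrow>
    (\<forall>n. E n \<in> sets borel \<and> E n \<subseteq> A \<and> Q (E n) \<and> \<nu> (E n) \<le> 0) \<and> disjoint_family E \<and>
    (\<forall>F\<in>sets borel. F \<subseteq> A - (\<Union>n. E n) \<longrightarrow> Q F \<longrightarrow> 0 \<le> \<nu> F)"

lemma signed_exhaustion: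
  fixes \<nu> :: "'a::topological_space set \<Rightarrow> real"
  assumes \<nu>: "finite_signed_measure \<nu>" and Q: "Q {}"
  obtains E where "exhausts \<nu> Q A E"
proof -
  define X where "X D = {F \<in> sets borel. F \<subseteq> A - D \<and> Q F}" for D
  have X0: "{} \<in> X D" for D using Q by (simp add: X_def)
  have "\<exists>x\<in>X D. \<forall>y\<in>X D. \<nu> x \<le> max (\<nu> y / 2) (-1)" for D
    by (rule ex_nearly_minimal[OF X0]) (simp add: finite_signed_measure_empty[OF \<nu>])
  then obtain g where g: "\<And>D. g D \<in> X D" "\<And>D y. y \<in> X D \<Longrightarrow> \<nu> (g D) \<le> max (\<nu> y / 2) (-1)"
    by metis
  \<comment> \<open>\<open>U n\<close> collects what is removed before stage n, and \<open>g\<close>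
    chooses the next set from the rest.\<close>
  define U where "U = rec_nat {} (\<lambda>_ D. D \<union> g D)"
  have U_Suc: "U (Suc n) = U n \<union> g (U n)" for n by (simp add: U_def)
  define E where "E n = g (U n)" for n
  have EX: "E n \<in> X (U n)" for n using g by (simp add: E_def)
  have "incseq U" by (rule incseq_SucI) (auto simp: U_Suc)
  have EU: "E i \<subseteq> U j" if "i < j" for i j
    using monoD[OF \<open>incseq U\<close>, of "Suc i" j] that by (auto simp: U_Suc E_def)
  have U_un: "U n \<subseteq> (\<Union>n. E n)" for n
    by (induction n) (auto simp: U_Suc E_def, simp add: U_def)
  have disj: "disjoint_family E"
  proof (unfold disjoint_family_on_def, safe)
    fix m n x assume "m \<noteq> n" "x \<in> E m" "x \<in> E n"
    then show "x \<in> {}" using EU[of m n] EU[of n m] EX[of m] EX[of n]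
      by (auto simp: X_def neq_iff)
  qed
  have E: "E n \<in> sets borel" "E n \<subseteq> A" "Q (E n)" for n using EX[of n] by (auto simp: X_def)
  have neg: "\<nu> (E n) \<le> 0" for n
    using g(2)[OF X0, of "U n"] by (simp add: E_def finite_signed_measure_empty[OF \<nu>])
  \<comment> \<open>Countable additivity makes the series of removed masses converge, so its terms
    tend to 0.\<close>
  have lim: "(\<lambda>n. \<nu> (E n)) \<longlonglongrightarrow> 0"
    by (rule summable_LIMSEQ_zero) (use finite_signed_measure_sums[OF \<nu> E(1) disj] in \<open>auto simp: sums_iff\<close>)
  \<comment> \<open>A leftover \<open>F\<close> is a candidate at every stage, so
    \<open>\<nu> (E n) \<le> max (\<nu> F / 2) (-1)\<close> for all n. In the limit this maximum is
    nonnegative, which the entry -1 cannot achieve.\<close>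
  have "0 \<le> \<nu> F" if "F \<in> sets borel" "F \<subseteq> A - (\<Union>n. E n)" "Q F" for F
  proof -
    have "F \<in> X (U n)" for n using that U_un[of n] by (auto simp: X_def)
    then have "0 \<le> max (\<nu> F / 2) (-1)"
      by (intro tendsto_upperbound[OF lim]) (auto simp: E_def intro!: always_eventually g)
    then show ?thesis by (simp add: max_def split: if_splits)
  qed
  with E neg disj show ?thesis by (intro that[of E]) (auto simp: exhausts_def)
qed

definition hahn_set :: "('a::topological_space set \<Rightarrow> real) \<Rightarrow> 'a set \<Rightarrow> bool" where
  "hahn_set \<nu> P \<longleftrightarrow> P \<in> sets borel \<and> (\<forall>B\<in>sets borel. B \<subseteq> P \<longrightarrow> 0 \<le> \<nu> B) \<and>
     (\<forall>B\<in>sets borel. B \<inter> P = {} \<longrightarrow> \<nu> B \<le> 0)"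

lemma hahn_set_borel: "hahn_set \<nu> P \<Longrightarrow> P \<in> sets borel"
  and hahn_set_nonneg: "hahn_set \<nu> P \<Longrightarrow> B \<in> sets borel \<Longrightarrow> B \<subseteq> P \<Longrightarrow> 0 \<le> \<nu> B"
  and hahn_set_nonpos: "hahn_set \<nu> P \<Longrightarrow> B \<in> sets borel \<Longrightarrow> B \<inter> P = {} \<Longrightarrow> \<nu> B \<le> 0"
  unfolding hahn_set_def by blast+

lemma hahn_set_uminus: "hahn_set \<nu> P \<Longrightarrow> hahn_set (\<lambda>A. - \<nu> A) (- P)"
  by (auto simp: hahn_set_def)

text \<open>Discarding an exhausting family of sets of nonpositive measure cannot lower the measure
  of \<open>A\<close>, and the rest has no subset of negative measure.\<close>

lemma ex_positive_subset:
  fixes \<nu> :: "'a::topological_space set \<Rightarrow> real"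
  assumes \<nu>: "finite_signed_measure \<nu>" and A: "A \<in> sets borel"
  shows "\<exists>B\<in>sets borel. B \<subseteq> A \<and> \<nu> A \<le> \<nu> B \<and> (\<forall>F\<in>sets borel. F \<subseteq> B \<longrightarrow> 0 \<le> \<nu> F)"
proof -
  obtain E where "exhausts \<nu> (\<lambda>_. True) A E"
    using signed_exhaustion[OF \<nu>, of "\<lambda>_. True" A] by blast
  then have E: "\<And>n. E n \<in> sets borel" "\<And>n. E n \<subseteq> A" "\<And>n. \<nu> (E n) \<le> 0" "disjoint_family E"
    "\<And>F. F \<in> sets borel \<Longrightarrow> F \<subseteq> A - (\<Union>n. E n) \<Longrightarrow> 0 \<le> \<nu> F"
    by (auto simp: exhausts_def)
  have "\<nu> (\<Union>n. E n) \<le> 0"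
    by (rule sums_le[OF E(3) finite_signed_measure_sums[OF \<nu> E(1,4)] sums_zero])
  moreover have "\<nu> (A - (\<Union>n. E n)) = \<nu> A - \<nu> (\<Union>n. E n)"
    using E A by (intro finite_signed_measure_Diff[OF \<nu>]) auto
  ultimately show ?thesis using E A by (intro bexI[of _ "A - (\<Union>n. E n)"]) auto
qed

text \<open>A second exhaustion, of -\<nu> and over positive sets only, yields \<open>P\<close> as a
  union. A set of positive measure disjoint from \<open>P\<close> would contain a positive set of at
  least that measure by \<open>ex_positive_subset\<close>, contradicting exhaustion.\<close>

theorem ex_hahn_set:
  fixes \<nu> :: "'a::topological_space set \<Rightarrow> real"
  assumes \<nu>: "finite_signed_measure \<nu>"
  obtains P where "hahn_set \<nu> P"
proof -
  define Q where "Q B \<longleftrightarrow> (\<forall>F\<in>sets borel. F \<subseteq> B \<longrightarrow> 0 \<le> \<nu> F)" for B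
  have "Q {}" by (auto simp: Q_def finite_signed_measure_empty[OF \<nu>])
  then obtain E where "exhausts (\<lambda>A. - \<nu> A) Q UNIV E"
    using signed_exhaustion[OF finite_signed_measure_uminus[OF \<nu>]] by blast
  then have E: "\<And>n. E n \<in> sets borel" "\<And>n. Q (E n)" "disjoint_family E"
    "\<And>F. F \<in> sets borel \<Longrightarrow> F \<inter> (\<Union>n. E n) = {} \<Longrightarrow> Q F \<Longrightarrow> \<nu> F \<le> 0"
    unfolding exhausts_def by (auto simp: disjoint_eq_subset_Compl Compl_eq_Diff_UNIV)
  let ?P = "\<Union>n. E n"
  have "0 \<le> \<nu> B" if B: "B \<in> sets borel" "B \<subseteq> ?P" for B
  proof -
    have sums: "(\<lambda>n. \<nu> (B \<inter> E n)) sums \<nu> (\<Union>n. B \<inter> E n)"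
      using B E disjoint_family_subset[OF E(3), of "\<lambda>n. B \<inter> E n"]
      by (intro finite_signed_measure_sums[OF \<nu>]) auto
    have "0 \<le> \<nu> (B \<inter> E n)" for n
      using E(1,2)[of n] B(1) unfolding Q_def by (metis Int_lower2 sets.Int)
    then have "0 \<le> \<nu> (\<Union>n. B \<inter> E n)" by (rule sums_le[OF _ sums_zero sums])
    moreover have "(\<Union>n. B \<inter> E n) = B" using B by auto
    ultimately show ?thesis by simp
  qed
  moreover have "\<nu> B \<le> 0" if B: "B \<in> sets borel" "B \<inter> ?P = {}" for B
  proof -
    obtain F where "F \<in> sets borel" "F \<subseteq> B" "\<nu> B \<le> \<nu> F" "Q F"
      using ex_positive_subset[OF \<nu> B(1)] by (auto simp: Q_def)
    with E(4)[of F] B show ?thesis by fastforce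
  qed
  ultimately show ?thesis using E by (intro that[of ?P]) (auto simp: hahn_set_def)
qed

section \<open>The upper variation and the Jordan decomposition\<close>

lemma sets_upper_variation [simp, measurable_cong]: "sets (upper_variation \<nu>) = sets borel"
  unfolding upper_variation_def
  by (subst sets_measure_of) (use sets.sigma_sets_eq[of borel] in auto)

lemma space_upper_variation [simp]: "space (upper_variation \<nu>) = UNIV"
  by (simp add: upper_variation_def)

text \<open>The supremum is attained at \<open>A \<inter> P\<close>: neither dropping the part of
  \<open>B\<close> outside \<open>P\<close> nor enlarging \<open>B \<inter> P\<close> to
  \<open>A \<inter> P\<close> lowers the value. Countable additivity is then inherited from
  \<nu>.\<close>

lemma emeasure_upper_variation:
  fixes \<nu> :: "'a::topological_space set \<Rightarrow> real"
  assumes \<nu>: "finite_signed_measure \<nu>" and P: "hahn_set \<nu> P" and A: "A \<in> sets borel"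
  shows "emeasure (upper_variation \<nu>) A = ennreal (\<nu> (A \<inter> P))"
proof -
  have Pb: "P \<in> sets borel" using P by (simp add: hahn_set_def)
  have sup: "(SUP B\<in>{B \<in> sets borel. B \<subseteq> A}. ennreal (\<nu> B)) = ennreal (\<nu> (A \<inter> P))"
    if A: "A \<in> sets borel" for A
  proof (rule antisym)
    show "(SUP B\<in>{B \<in> sets borel. B \<subseteq> A}. ennreal (\<nu> B)) \<le> ennreal (\<nu> (A \<inter> P))"
    proof (rule SUP_least, clarify, rule ennreal_leI)
      fix B assume B: "B \<in> sets borel" "B \<subseteq> A"
      have "\<nu> B = \<nu> (B \<inter> P) + \<nu> (B - P)" by (rule finite_signed_measure_split[OF \<nu> B(1) Pb])
      moreover have "\<nu> (B - P) \<le> 0" using B Pb by (intro hahn_set_nonpos[OF P]) auto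
      moreover have "\<nu> (A \<inter> P - B \<inter> P) = \<nu> (A \<inter> P) - \<nu> (B \<inter> P)"
        using A B Pb by (intro finite_signed_measure_Diff[OF \<nu>]) auto
      moreover have "0 \<le> \<nu> (A \<inter> P - B \<inter> P)" using A B Pb by (intro hahn_set_nonneg[OF P]) auto
      ultimately show "\<nu> B \<le> \<nu> (A \<inter> P)" by linarith
    qed
    show "ennreal (\<nu> (A \<inter> P)) \<le> (SUP B\<in>{B \<in> sets borel. B \<subseteq> A}. ennreal (\<nu> B))"
      using A Pb by (intro SUP_upper) auto
  qed
  have "countably_additive (sets borel) (\<lambda>A. SUP B\<in>{B \<in> sets borel. B \<subseteq> A}. ennreal (\<nu> B))"
  proof (rule countably_additiveI)
    fix F :: "nat \<Rightarrow> 'a set" assume F: "range F \<subseteq> sets borel" "disjoint_family F"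
    have sums: "(\<lambda>i. \<nu> (F i \<inter> P)) sums \<nu> (\<Union>i. F i \<inter> P)"
      using F Pb by (intro finite_signed_measure_sums[OF \<nu>]) (auto simp: disjoint_family_on_def)
    have "0 \<le> \<nu> (F i \<inter> P)" for i using F Pb by (intro hahn_set_nonneg[OF P]) auto
    then have "(\<Sum>i. ennreal (\<nu> (F i \<inter> P))) = ennreal (\<nu> (\<Union>i. F i \<inter> P))"
      using sums by (intro suminf_ennreal_eq) auto
    also have "(\<Union>i. F i \<inter> P) = \<Union> (range F) \<inter> P" by auto
    finally show "(\<Sum>i. SUP B\<in>{B \<in> sets borel. B \<subseteq> F i}. ennreal (\<nu> B)) =
        (SUP B\<in>{B \<in> sets borel. B \<subseteq> \<Union> (range F)}. ennreal (\<nu> B))"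
      using F by (subst (1 2) sup) auto
  qed
  moreover have "positive (sets borel) (\<lambda>A. SUP B\<in>{B \<in> sets borel. B \<subseteq> A}. ennreal (\<nu> B))"
    by (simp add: positive_def sup finite_signed_measure_empty[OF \<nu>])
  ultimately have "emeasure (upper_variation \<nu>) A = (SUP B\<in>{B \<in> sets borel. B \<subseteq> A}. ennreal (\<nu> B))"
    using A by (intro emeasure_measure_of[OF upper_variation_def[of \<nu>]]) auto
  then show ?thesis using sup[OF A] by simp
qed

lemma finite_measure_upper_variation:
  assumes "finite_signed_measure \<nu>"
  shows "finite_measure (upper_variation \<nu>)"
proof -
  obtain P where "hahn_set \<nu> P" using ex_hahn_set[OF assms] .
  then show ?thesis
    using assms by (intro finite_measureI) (simp add: emeasure_upper_variation)
qed

lemma measure_upper_variation: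
  assumes "finite_signed_measure \<nu>" "hahn_set \<nu> P" "A \<in> sets borel"
  shows "measure (upper_variation \<nu>) A = \<nu> (A \<inter> P)"
  using assms unfolding measure_def
  by (subst emeasure_upper_variation) (use hahn_set_nonneg[of \<nu> P "A \<inter> P"] hahn_set_borel[of \<nu> P] in auto)

text \<open>The complement of a Hahn set of \<nu> is one of -\<nu>, so the two variations see
  \<open>A \<inter> P\<close> and \<open>A - P\<close> respectively.\<close>

theorem jordan_decomposition:
  assumes \<nu>: "finite_signed_measure \<nu>" and A: "A \<in> sets borel"
  shows "\<nu> A = measure (upper_variation \<nu>) A - measure (upper_variation (\<lambda>A. - \<nu> A)) A"
proof -
  obtain P where P: "hahn_set \<nu> P" using ex_hahn_set[OF \<nu>] .
  have "measure (upper_variation (\<lambda>A. - \<nu> A)) A = - \<nu> (A \<inter> - P)"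
    by (rule measure_upper_variation[OF finite_signed_measure_uminus[OF \<nu>] hahn_set_uminus[OF P] A])
  moreover have "\<nu> A = \<nu> (A \<inter> P) + \<nu> (A - P)"
    using P by (intro finite_signed_measure_split[OF \<nu> A]) (simp add: hahn_set_def)
  ultimately show ?thesis using measure_upper_variation[OF \<nu> P A] by (simp add: Diff_eq)
qed

text \<open>Lets a set function known only on Borel sets be exchanged for an explicit
  formula.\<close>

lemma upper_variation_cong:
  assumes "\<And>A. A \<in> sets borel \<Longrightarrow> \<nu> A = \<nu>' A"
  shows "upper_variation \<nu> = upper_variation \<nu>'"
proof -
  have "(SUP B\<in>{B \<in> sets borel. B \<subseteq> A}. ennreal (\<nu> B)) =
        (SUP B\<in>{B \<in> sets borel. B \<subseteq> A}. ennreal (\<nu>' B))" for A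
    using assms by (intro SUP_cong) auto
  then show ?thesis unfolding upper_variation_def by simp
qed

section \<open>Integrals against finitely supported signed measures\<close>

lemma integral_finite_support:
  fixes f :: "'a::t1_space \<Rightarrow> real"
  assumes M: "finite_measure M" "sets M = sets borel"
    and F: "finite F" "emeasure M (- F) = 0" and f: "f \<in> borel_measurable borel"
  shows "integral\<^sup>L M f = (\<Sum>x\<in>F. measure M {x} * f x)"
proof -
  interpret finite_measure M by fact
  have sp: "space M = UNIV" using sets_eq_imp_space_eq[OF M(2)] by simp
  have Fb: "F \<in> sets M" "- F \<in> sets M" "\<And>x. {x} \<in> sets M"
    using finite_imp_closed[OF F(1)] by (auto simp: M(2))
  have "AE x in M. x \<notin> - F"
    by (rule AE_not_in) (use F Fb in auto)
  then have "AE x in M. f x = (\<Sum>y\<in>F. f y * indicator {y} x)"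
  proof eventually_elim
    fix x assume "x \<notin> - F"
    then have "(\<Sum>y\<in>F. f y * indicator {y} x) = (\<Sum>y\<in>{x}. f y * indicator {y} x)"
      using F by (intro sum.mono_neutral_right) (auto simp: indicator_def)
    then show "f x = (\<Sum>y\<in>F. f y * indicator {y} x)" by simp
  qed
  then have "integral\<^sup>L M f = (\<integral>x. (\<Sum>y\<in>F. f y * indicator {y} x) \<partial>M)"
    by (intro integral_cong_AE) (use f Fb M in \<open>auto cong: measurable_cong_sets\<close>)
  also have "\<dots> = (\<Sum>y\<in>F. \<integral>x. f y * indicator {y} x \<partial>M)"
    using Fb by (intro Bochner_Integration.integral_sum) (auto simp: less_top[symmetric])
  also have "\<dots> = (\<Sum>x\<in>F. measure M {x} * f x)"
    by (simp add: sp mult.commute)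
  finally show ?thesis .
qed

lemma finite_signed_measure_discrete:
  "finite_signed_measure (\<lambda>A. \<Sum>t\<in>T. w t * indicator A (y t))"
  unfolding finite_signed_measure_def
  by (auto intro!: sums_sum sums_mult indicator_sums simp: disjoint_family_on_def)

text \<open>The points \<open>y t\<close> may coincide, so atoms are first grouped over the image of
  \<open>y\<close>. Both variations vanish off this finite set, and the Jordan decomposition
  recombines their point masses.\<close>

lemma signed_integral_discrete:
  fixes y :: "'b \<Rightarrow> 'a::t1_space" and f :: "'a \<Rightarrow> real"
  assumes T: "finite T" and f: "f \<in> borel_measurable borel"
    and \<nu>: "\<And>A. A \<in> sets borel \<Longrightarrow> \<nu> A = (\<Sum>t\<in>T. w t * indicator A (y t))"
  shows "signed_integral \<nu> f = (\<Sum>t\<in>T. w t * f (y t))"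
proof -
  define \<nu>' where "\<nu>' A = (\<Sum>t\<in>T. w t * indicator A (y t))" for A
  have fsm: "finite_signed_measure \<nu>'"
    unfolding \<nu>'_def by (rule finite_signed_measure_discrete)
  have int: "integral\<^sup>L (upper_variation \<kappa>) f = (\<Sum>x\<in>y ` T. measure (upper_variation \<kappa>) {x} * f x)"
    if \<kappa>: "finite_signed_measure \<kappa>" and 0: "\<And>A. A \<inter> y ` T = {} \<Longrightarrow> \<kappa> A = 0" for \<kappa>
  proof (rule integral_finite_support)
    obtain P where P: "hahn_set \<kappa> P" using ex_hahn_set[OF \<kappa>] .
    have "- y ` T \<in> sets borel" using T by (intro borel_open open_Compl finite_imp_closed) simp
    then show "emeasure (upper_variation \<kappa>) (- y ` T) = 0"
      by (subst emeasure_upper_variation[OF \<kappa> P]) (use 0[of "- y ` T \<inter> P"] in auto)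
  qed (use T f \<kappa> in \<open>auto intro: finite_measure_upper_variation\<close>)
  have null: "\<nu>' A = 0" if "A \<inter> y ` T = {}" for A
    unfolding \<nu>'_def using that by (intro sum.neutral) (auto simp: indicator_def)
  have "signed_integral \<nu> f = signed_integral \<nu>' f"
    using upper_variation_cong[of \<nu> \<nu>'] upper_variation_cong[of "\<lambda>A. - \<nu> A" "\<lambda>A. - \<nu>' A"] \<nu>
    by (simp add: signed_integral_def \<nu>'_def)
  also have "\<dots> = (\<Sum>x\<in>y ` T. \<nu>' {x} * f x)"
    unfolding signed_integral_def
    by (subst (1 2) int) (auto simp: fsm finite_signed_measure_uminus null jordan_decomposition[OF fsm]
        sum_subtractf[symmetric] left_diff_distrib)
  also have "\<dots> = (\<Sum>x\<in>y ` T. \<Sum>t\<in>T. if y t = x then w t * f (y t) else 0)"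
    unfolding \<nu>'_def sum_distrib_right by (intro sum.cong refl) (auto simp: indicator_def)
  also have "\<dots> = (\<Sum>t\<in>T. w t * f (y t))"
    using T by (subst sum.swap) (auto intro!: sum.cong)
  finally show ?thesis .
qed

section \<open>Measures bounded in the \<open>L\<^sup>2\<close> norm\<close>

lemma signed_integral_tendsto:
  fixes f :: "nat \<Rightarrow> 'a::topological_space \<Rightarrow> real"
  assumes \<nu>: "finite_signed_measure \<nu>" and f: "\<And>n. f n \<in> borel_measurable borel"
    and g: "g \<in> borel_measurable borel" and bound: "\<And>n x. \<bar>f n x\<bar> \<le> C"
    and lim: "\<And>x. (\<lambda>n. f n x) \<longlonglongrightarrow> g x"
  shows "(\<lambda>n. signed_integral \<nu> (f n)) \<longlonglongrightarrow> signed_integral \<nu> g"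
proof -
  have "(\<lambda>n. integral\<^sup>L (upper_variation \<kappa>) (f n)) \<longlonglongrightarrow> integral\<^sup>L (upper_variation \<kappa>) g"
    if "finite_signed_measure \<kappa>" for \<kappa>
  proof -
    interpret finite_measure "upper_variation \<kappa>" using finite_measure_upper_variation[OF that] .
    show ?thesis
      by (rule integral_dominated_convergence[where w = "\<lambda>_. C"]) (use f g lim bound in auto)
  qed
  then show ?thesis
    unfolding signed_integral_def using \<nu> finite_signed_measure_uminus[OF \<nu>] by (intro tendsto_diff)
qed

lemma signed_integral_indicator:
  assumes "finite_signed_measure \<nu>" "A \<in> sets borel"
  shows "signed_integral \<nu> (indicator A) = \<nu> A"
  using jordan_decomposition[OF assms] by (simp add: signed_integral_def)

text \<open>The Cauchy-Schwarz bound that a density of norm at most 1 would satisfy, restricted to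
  test functions to which Riemann sums apply.\<close>

definition L2_bounded :: "('a::euclidean_space set \<Rightarrow> real) \<Rightarrow> bool" where
  "L2_bounded \<nu> \<longleftrightarrow> (\<forall>f. continuous_on UNIV f \<longrightarrow> bounded {x. f x \<noteq> 0} \<longrightarrow>
     (signed_integral \<nu> f)\<^sup>2 \<le> (LINT x|lborel. (f x)\<^sup>2))"

lemma L2_boundedD:
  assumes "L2_bounded \<nu>" "continuous_on UNIV f" "\<And>x. f x \<noteq> 0 \<Longrightarrow> x \<in> cball 0 R"
  shows "(signed_integral \<nu> f)\<^sup>2 \<le> (LINT x|lborel. (f x)\<^sup>2)"
proof -
  have "{x. f x \<noteq> 0} \<subseteq> cball 0 R" using assms(3) by blast
  then have "bounded {x. f x \<noteq> 0}" by (rule bounded_subset[OF bounded_cball])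
  with assms(1,2) show ?thesis unfolding L2_bounded_def by simp
qed

lemma L2_bounded_compact_null:
  fixes \<nu> :: "'a::euclidean_space set \<Rightarrow> real"
  assumes \<nu>: "finite_signed_measure \<nu>" and L2: "L2_bounded \<nu>"
    and K: "compact K" "measure lborel K = 0"
  shows "\<nu> K = 0"
proof (cases "K = {}")
  \<comment> \<open>Treated apart because \<open>infdist\<close> to the empty set is 0 by
    convention, so the functions below would be constantly 1.\<close>
  case True
  then show ?thesis by (simp add: finite_signed_measure_empty[OF \<nu>])
next
  case False
  obtain B where B: "\<And>x. x \<in> K \<Longrightarrow> norm x \<le> B"
    using compact_imp_bounded[OF K(1)] by (auto simp: bounded_iff)
  \<comment> \<open>Tents over \<open>K\<close> of width 1 / (n + 1). The width never exceeds 1, so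
    the indicator of one ball of radius \<open>B + 1\<close> dominates all their squares.\<close>
  define g where "g n x = max 0 (1 - real (Suc n) * infdist x K)" for n x
  have cont: "continuous_on UNIV (g n)" for n
    unfolding g_def by (intro continuous_intros)
  have meas [measurable]: "g n \<in> borel_measurable borel" for n
    using cont by (rule borel_measurable_continuous_onI)
  have g01: "0 \<le> g n x" "g n x \<le> 1" for n x
    by (auto simp: g_def infdist_nonneg)
  have supp: "x \<in> cball 0 (B + 1)" if "g n x \<noteq> 0" for n x
  proof -
    have "real (Suc n) * infdist x K < 1" using that by (auto simp: g_def max_def split: if_splits)
    moreover have "infdist x K \<le> real (Suc n) * infdist x K"
      using infdist_nonneg[of x K] by (simp add: algebra_simps)
    ultimately have "infdist x K < 1" by linarith
    moreover obtain k where "k \<in> K" "infdist x K = dist x k"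
      using infdist_attains_inf[OF compact_imp_closed[OF K(1)] False] by metis
    ultimately show ?thesis
      using B[of k] norm_triangle_sub[of x k] by (simp add: dist_norm)
  qed
  have lim: "(\<lambda>n. g n x) \<longlonglongrightarrow> indicator K x" for x
  proof (cases "x \<in> K")
    case True
    then show ?thesis by (simp add: g_def)
  next
    case False
    then have "infdist x K > 0"
      using K(1) \<open>K \<noteq> {}\<close> by (simp add: infdist_pos_not_in_closed compact_imp_closed)
    then obtain N where N: "inverse (real (Suc N)) < infdist x K"
      using reals_Archimedean by blast
    have "g n x = 0" if "n \<ge> N" for n
    proof -
      have "1 \<le> real (Suc N) * infdist x K" using N by (simp add: field_simps)
      also have "\<dots> \<le> real (Suc n) * infdist x K"
        using that by (intro mult_right_mono) (auto simp: infdist_nonneg)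
      finally show ?thesis by (simp add: g_def)
    qed
    then show ?thesis
      using False by (auto intro!: tendsto_eventually eventually_sequentiallyI)
  qed
  have Kb: "K \<in> sets borel" using K by (simp add: borel_closed compact_imp_closed)
  have lim1: "(\<lambda>n. (signed_integral \<nu> (g n))\<^sup>2) \<longlonglongrightarrow> (signed_integral \<nu> (indicator K))\<^sup>2"
    by (intro tendsto_power signed_integral_tendsto[OF \<nu>, where C = 1] lim)
      (use Kb g01 in \<open>auto simp: abs_le_iff intro: order_trans[OF _ g01(1)]\<close>)
  have lim2: "(\<lambda>n. LINT x|lborel. (g n x)\<^sup>2) \<longlonglongrightarrow> (LINT x|lborel. (indicator K x :: real)\<^sup>2)"
  proof (rule integral_dominated_convergence[where w = "indicator (cball 0 (B + 1))"])
    show "integrable lborel (indicator (cball 0 (B + 1)) :: 'a \<Rightarrow> real)"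
      by (intro integrable_real_indicator) (use emeasure_bounded_finite[OF bounded_cball, of 0 "B + 1"] in auto)
    have "norm ((g n x)\<^sup>2) \<le> indicator (cball 0 (B + 1)) x" for n x
      using supp[of n x] g01[of n x] by (auto simp: indicator_def power_le_one)
    then show "AE x in lborel. norm ((g n x)\<^sup>2) \<le> indicator (cball 0 (B + 1)) x" for n
      by simp
  qed (use Kb in \<open>auto intro!: tendsto_power lim\<close>)
  have "(signed_integral \<nu> (indicator K))\<^sup>2 \<le> (LINT x|lborel. (indicator K x :: real)\<^sup>2)"
    by (intro LIMSEQ_le[OF lim1 lim2] exI allI impI L2_boundedD[OF L2 cont supp])
  also have "(\<lambda>x. (indicator K x :: real)\<^sup>2) = indicator K" by (auto simp: indicator_def)
  finally have "(\<nu> K)\<^sup>2 \<le> 0"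
    using K(2) Kb by (simp add: signed_integral_indicator[OF \<nu>])
  then show ?thesis by simp
qed

text \<open>Inner regularity of a finite Borel measure reduces the claim to compact subsets of a
  null set. Intersecting with a Hahn set first makes the variation of such a compact set equal to
  its \<nu>-value.\<close>

lemma absolutely_continuous_upper_variation:
  fixes \<nu> :: "'a::euclidean_space set \<Rightarrow> real"
  assumes \<nu>: "finite_signed_measure \<nu>"
    and null: "\<And>K. compact K \<Longrightarrow> measure lborel K = 0 \<Longrightarrow> \<nu> K = 0"
  shows "absolutely_continuous lborel (upper_variation \<nu>)"
  unfolding absolutely_continuous_def
proof
  fix A :: "'a set" assume A: "A \<in> null_sets lborel"
  obtain P where P: "hahn_set \<nu> P" using ex_hahn_set[OF \<nu>] .
  have Pb: "P \<in> sets borel" using P by (rule hahn_set_borel)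
  have Ab: "A \<in> sets borel" using A by auto
  interpret finite_measure "upper_variation \<nu>" using finite_measure_upper_variation[OF \<nu>] .
  have "emeasure (upper_variation \<nu>) A = emeasure (upper_variation \<nu>) (A \<inter> P)"
    using Ab Pb by (simp add: emeasure_upper_variation[OF \<nu> P] Int_assoc)
  also have "\<dots> = (SUP K\<in>{K. K \<subseteq> A \<inter> P \<and> compact K}. emeasure (upper_variation \<nu>) K)"
    using Ab Pb by (intro inner_regular) auto
  also have "\<dots> \<le> 0"
  proof (rule SUP_least, clarify)
    fix K assume K: "K \<subseteq> A \<inter> P" "compact K"
    then have Kb: "K \<in> sets borel" by (simp add: borel_closed compact_imp_closed)
    then have "K \<in> null_sets lborel" using null_sets_subset[OF A] K by auto
    then have "\<nu> K = 0" using null[OF K(2)] by (simp add: measure_eq_0_null_sets)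
    moreover have "K \<inter> P = K" using K by auto
    ultimately show "emeasure (upper_variation \<nu>) K \<le> 0"
      using Kb by (simp add: emeasure_upper_variation[OF \<nu> P])
  qed
  finally show "A \<in> null_sets (upper_variation \<nu>)" using Ab by (simp add: null_sets_def)
qed

section \<open>Existence of the density and its norm\<close>

text \<open>Radon-Nikodym; finiteness of \<open>N\<close> makes the derivative real-valued almost
  everywhere and integrable.\<close>

lemma ex_real_density:
  fixes N :: "'a::euclidean_space measure"
  assumes N: "finite_measure N" "sets N = sets borel" "absolutely_continuous lborel N"
  obtains D :: "'a \<Rightarrow> real" where "integrable lborel D"
    "\<And>f :: 'a \<Rightarrow> real. f \<in> borel_measurable borel \<Longrightarrow> integral\<^sup>L N f = (LINT x|lborel. D x * f x)"
proof -
  interpret N: finite_measure N by fact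
  obtain D :: "'a \<Rightarrow> real" where D [measurable]: "D \<in> borel_measurable lborel"
    and DRN: "AE x in lborel. RN_deriv lborel N x = ennreal (D x)" and D0: "\<And>x. 0 \<le> D x"
    by (rule sigma_finite_measure.real_RN_deriv[OF sigma_finite_lborel N(1,3)])
      (simp add: N(2), rule that)
  have "N = density lborel (RN_deriv lborel N)"
    using N by (intro sigma_finite_measure.density_RN_deriv[OF sigma_finite_lborel, symmetric]) auto
  also have "\<dots> = density lborel (\<lambda>x. ennreal (D x))"
    using DRN by (intro density_cong) auto
  finally have eq: "N = density lborel (\<lambda>x. ennreal (D x))" .
  have "(\<integral>\<^sup>+ x. ennreal (D x) \<partial>lborel) = emeasure N UNIV"
    by (subst eq) (simp add: emeasure_density)
  then have "integrable lborel D"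
    using D0 by (intro integrableI_nonneg) (auto simp: less_top[symmetric])
  moreover have "integral\<^sup>L N f = (LINT x|lborel. D x * f x)"
    if "f \<in> borel_measurable borel" for f :: "'a \<Rightarrow> real"
    using that D0 by (subst eq) (simp add: integral_density)
  ultimately show ?thesis by (rule that)
qed

text \<open>The density is the difference of those of the two variations. Boundedness of
  \<open>f\<close> makes both products with \<open>f\<close> integrable, so that the integrals may
  be subtracted.\<close>

lemma L2_bounded_ex_density:
  fixes \<nu> :: "'a::euclidean_space set \<Rightarrow> real"
  assumes \<nu>: "finite_signed_measure \<nu>" and L2: "L2_bounded \<nu>"
  obtains \<phi> :: "'a \<Rightarrow> real" where "integrable lborel \<phi>"
    "\<And>f C. f \<in> borel_measurable borel \<Longrightarrow> (\<And>x. \<bar>f x\<bar> \<le> C) \<Longrightarrow>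
       signed_integral \<nu> f = (LINT x|lborel. \<phi> x * f x)"
proof -
  note null = L2_bounded_compact_null[OF \<nu> L2]
  note \<nu>' = finite_signed_measure_uminus[OF \<nu>]
  obtain D where D: "integrable lborel D"
    "\<And>f :: 'a \<Rightarrow> real. f \<in> borel_measurable borel \<Longrightarrow>
      integral\<^sup>L (upper_variation \<nu>) f = (LINT x|lborel. D x * f x)"
    using ex_real_density[OF finite_measure_upper_variation[OF \<nu>] sets_upper_variation
        absolutely_continuous_upper_variation[OF \<nu>]] null by blast
  obtain D' where D': "integrable lborel D'"
    "\<And>f :: 'a \<Rightarrow> real. f \<in> borel_measurable borel \<Longrightarrow>
      integral\<^sup>L (upper_variation (\<lambda>A. - \<nu> A)) f = (LINT x|lborel. D' x * f x)"
    using ex_real_density[OF finite_measure_upper_variation[OF \<nu>'] sets_upper_variation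
        absolutely_continuous_upper_variation[OF \<nu>']] null by auto
  show ?thesis
  proof (rule that[of "\<lambda>x. D x - D' x"])
    show "integrable lborel (\<lambda>x. D x - D' x)" using D D' by simp
    fix f :: "'a \<Rightarrow> real" and C assume f: "f \<in> borel_measurable borel" "\<And>x. \<bar>f x\<bar> \<le> C"
    have "integrable lborel (\<lambda>x. h x * f x)" if "integrable lborel h" for h
    proof (rule Bochner_Integration.integrable_bound[of _ "\<lambda>x. C * h x"])
      have "norm (h x * f x) \<le> norm (C * h x)" for x
        using mult_right_mono[OF order_trans[OF f(2)[of x] abs_ge_self], of "\<bar>h x\<bar>"]
        by (simp add: abs_mult mult.commute)
      then show "AE x in lborel. norm (h x * f x) \<le> norm (C * h x)" by simp
    qed (use that f in auto)
    with D D' f show "signed_integral \<nu> f = (LINT x|lborel. (D x - D' x) * f x)"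
      by (simp add: signed_integral_def left_diff_distrib)
  qed
qed

text \<open>Testing against \<open>\<phi>\<close> truncated to a bounded function \<open>h\<close> of bounded support gives \<open>(\<integral>h\<^sup>2)\<^sup>2 \<le> \<integral>h\<^sup>2\<close>.\<close>

lemma L2_bounded_truncation:
  fixes \<nu> :: "'a::euclidean_space set \<Rightarrow> real" and C :: real
  assumes L2: "L2_bounded \<nu>" and \<phi>: "integrable lborel \<phi>"
    and int: "\<And>f C. f \<in> borel_measurable borel \<Longrightarrow> (\<And>x. \<bar>f x\<bar> \<le> C) \<Longrightarrow>
       signed_integral \<nu> f = (LINT x|lborel. \<phi> x * f x)"
    and C: "0 \<le> C" and h_def: "h = (\<lambda>x. if \<bar>\<phi> x\<bar> \<le> C \<and> norm x \<le> C then \<phi> x else 0)"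
  shows "integrable lborel (\<lambda>x. (h x)\<^sup>2)" "(LINT x|lborel. (h x)\<^sup>2) \<le> 1"
proof -
  have [measurable]: "\<phi> \<in> borel_measurable borel" using \<phi> by auto
  have h_meas [measurable]: "h \<in> borel_measurable borel" unfolding h_def by measurable
  have hC: "\<bar>h x\<bar> \<le> C" for x using C by (simp add: h_def)
  let ?w = "\<lambda>x::'a. C\<^sup>2 * indicator (cball 0 (C + 1)) x"
  have w: "integrable lborel ?w"
    by (intro integrable_mult_right integrable_real_indicator) (use emeasure_bounded_finite[OF bounded_cball, of 0 "C + 1"] in auto)
  have "\<bar>(h x)\<^sup>2\<bar> \<le> ?w x" for x
    using power_mono[OF hC abs_ge_zero, of x 2] by (auto simp: h_def indicator_def)
  then show h2: "integrable lborel (\<lambda>x. (h x)\<^sup>2)"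
    by (intro Bochner_Integration.integrable_bound[OF w]) (auto intro: order_trans[OF _ abs_ge_self])
  have "h \<in> borel_measurable lebesgue" using h_meas by (intro measurable_completion) simp
  \<comment> \<open>This supplies continuous functions converging to \<open>h\<close> off a
    negligible set.\<close>
  then have "h measurable_on UNIV"
    by (intro lebesgue_measurable_imp_measurable_on) (auto simp: lebesgue_on_UNIV_eq)
  then obtain Z g where Z: "negligible Z" and g: "\<And>n. continuous_on UNIV (g n)"
    and lim: "\<And>x. x \<notin> Z \<Longrightarrow> (\<lambda>n. g n x) \<longlonglongrightarrow> h x"
    by (auto simp: measurable_on_def)
  \<comment> \<open>The cutoff factor and the clamping to [-C, C] turn \<open>g n\<close> into
    admissible, uniformly bounded test functions. They do not change the limit, since
    \<open>h\<close> is bounded by \<open>C\<close> and vanishes outside the ball of radius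
    \<open>C\<close>.\<close>
  define k where "k n x = max 0 (min 1 (C + 1 - norm x)) * max (- C) (min C (g n x))" for n :: nat and x
  have cont: "continuous_on UNIV (k n)" for n
    unfolding k_def by (intro continuous_intros g)
  have meas [measurable]: "k n \<in> borel_measurable borel" for n
    using cont by (rule borel_measurable_continuous_onI)
  have kC: "\<bar>k n x\<bar> \<le> C" for n x
  proof -
    have "\<bar>k n x\<bar> \<le> 1 * C"
      unfolding k_def abs_mult using C by (intro mult_mono) auto
    then show ?thesis by simp
  qed
  have supp: "x \<in> cball 0 (C + 1)" if "k n x \<noteq> 0" for n x
    using that by (auto simp: k_def max_def min_def split: if_splits)
  have klim: "(\<lambda>n. k n x) \<longlonglongrightarrow> h x" if "x \<notin> Z" for x
  proof -
    have "(\<lambda>n. k n x) \<longlonglongrightarrow> max 0 (min 1 (C + 1 - norm x)) * max (- C) (min C (h x))"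
      unfolding k_def by (intro tendsto_intros lim that)
    also have "max 0 (min 1 (C + 1 - norm x)) * max (- C) (min C (h x)) = h x"
      using hC[of x] C by (auto simp: h_def)
    finally show ?thesis .
  qed
  \<comment> \<open>\<open>Z\<close> is null only for the completed measure; the almost sure
    convergence is carried back to \<open>lborel\<close>.\<close>
  have "AE x in lebesgue. x \<notin> Z"
    using Z by (intro AE_not_in) (simp add: negligible_iff_null_sets)
  then have AE: "AE x in lborel. (\<lambda>n. k n x) \<longlonglongrightarrow> h x"
    using klim by (subst AE_completion_iff[symmetric]) (auto elim!: eventually_mono)
  have "(\<lambda>n. LINT x|lborel. \<phi> x * k n x) \<longlonglongrightarrow> (LINT x|lborel. \<phi> x * h x)"
  proof (rule integral_dominated_convergence[where w = "\<lambda>x. \<bar>\<phi> x\<bar> * C"])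
    show "AE x in lborel. (\<lambda>n. \<phi> x * k n x) \<longlonglongrightarrow> \<phi> x * h x"
      using AE by eventually_elim (intro tendsto_intros)
    show "AE x in lborel. norm (\<phi> x * k n x) \<le> \<bar>\<phi> x\<bar> * C" for n
      using kC by (auto simp: abs_mult intro!: mult_left_mono)
  qed (use \<phi> in auto)
  then have "(\<lambda>n. signed_integral \<nu> (k n)) \<longlonglongrightarrow> (LINT x|lborel. \<phi> x * h x)"
    using int[OF meas kC] by simp
  \<comment> \<open>As \<open>h\<close> is everywhere \<phi> or 0, the pairing with \<phi> is the
    integral that also appears in the bound.\<close>
  moreover have "(\<lambda>x. \<phi> x * h x) = (\<lambda>x. (h x)\<^sup>2)" by (auto simp: h_def power2_eq_square)
  ultimately have lim1: "(\<lambda>n. (signed_integral \<nu> (k n))\<^sup>2) \<longlonglongrightarrow> (LINT x|lborel. (h x)\<^sup>2)\<^sup>2"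
    by (auto intro: tendsto_power)
  have lim2: "(\<lambda>n. LINT x|lborel. (k n x)\<^sup>2) \<longlonglongrightarrow> (LINT x|lborel. (h x)\<^sup>2)"
  proof (rule integral_dominated_convergence[where w = ?w])
    show "AE x in lborel. (\<lambda>n. (k n x)\<^sup>2) \<longlonglongrightarrow> (h x)\<^sup>2"
      using AE by eventually_elim (intro tendsto_intros)
    have "norm ((k n x)\<^sup>2) \<le> ?w x" for n x
      using power_mono[OF kC abs_ge_zero, of n x 2] supp[of n x] by (auto simp: indicator_def)
    then show "AE x in lborel. norm ((k n x)\<^sup>2) \<le> ?w x" for n by simp
  qed (use w in auto)
  have le: "(LINT x|lborel. (h x)\<^sup>2)\<^sup>2 \<le> (LINT x|lborel. (h x)\<^sup>2)"
    by (intro LIMSEQ_le[OF lim1 lim2] exI allI impI L2_boundedD[OF L2 cont supp])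
  show "(LINT x|lborel. (h x)\<^sup>2) \<le> 1"
  proof (rule ccontr)
    assume "\<not> (LINT x|lborel. (h x)\<^sup>2) \<le> 1"
    then show False
      using mult_strict_left_mono[of 1 "LINT x|lborel. (h x)\<^sup>2" "LINT x|lborel. (h x)\<^sup>2"] le
      by (simp add: power2_eq_square)
  qed
qed

text \<open>At each point the truncations eventually agree with \<phi>, so Fatou's lemma passes
  their bound 1 on to \<phi>. Testing with indicators identifies \<phi> as the density.\<close>

theorem L2_bounded_imp_square_integrable_density:
  fixes \<nu> :: "'a::euclidean_space set \<Rightarrow> real"
  assumes \<nu>: "finite_signed_measure \<nu>" and L2: "L2_bounded \<nu>"
  shows "\<exists>\<phi>. signed_density \<nu> \<phi> \<and> square_integrable \<phi> \<and> L2_norm \<phi> \<le> 1"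
proof -
  obtain \<phi> :: "'a \<Rightarrow> real" where \<phi>: "integrable lborel \<phi>"
    and int: "\<And>f C. f \<in> borel_measurable borel \<Longrightarrow> (\<And>x. \<bar>f x\<bar> \<le> C) \<Longrightarrow>
       signed_integral \<nu> f = (LINT x|lborel. \<phi> x * f x)"
    using L2_bounded_ex_density[OF \<nu> L2] by blast
  have [measurable]: "\<phi> \<in> borel_measurable borel" using \<phi> by auto
  define h where "h n x = (if \<bar>\<phi> x\<bar> \<le> real n \<and> norm x \<le> real n then \<phi> x else 0)" for n x
  have hn: "h n = (\<lambda>x. if \<bar>\<phi> x\<bar> \<le> real n \<and> norm x \<le> real n then \<phi> x else 0)" for n
    by (simp add: h_def fun_eq_iff)
  have h: "integrable lborel (\<lambda>x. (h n x)\<^sup>2)" "(LINT x|lborel. (h n x)\<^sup>2) \<le> 1" for n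
    using L2_bounded_truncation[OF L2 \<phi> _ of_nat_0_le_iff hn] int by blast+
  have [measurable]: "h n \<in> borel_measurable borel" for n unfolding h_def by measurable
  have "(\<integral>\<^sup>+x. ennreal ((\<phi> x)\<^sup>2) \<partial>lborel) = (\<integral>\<^sup>+x. liminf (\<lambda>n. ennreal ((h n x)\<^sup>2)) \<partial>lborel)"
  proof (rule nn_integral_cong)
    fix x
    obtain N where N: "max \<bar>\<phi> x\<bar> (norm x) \<le> real N" using real_arch_simple by blast
    have "h n x = \<phi> x" if "n \<ge> N" for n
      using N that by (auto simp: h_def dest: of_nat_mono[where 'a = real])
    then have "(\<lambda>n. ennreal ((h n x)\<^sup>2)) \<longlonglongrightarrow> ennreal ((\<phi> x)\<^sup>2)"
      by (intro tendsto_eventually eventually_sequentiallyI[of N]) simp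
    then show "ennreal ((\<phi> x)\<^sup>2) = liminf (\<lambda>n. ennreal ((h n x)\<^sup>2))"
      by (intro lim_imp_Liminf[symmetric]) auto
  qed
  also have "\<dots> \<le> liminf (\<lambda>n. \<integral>\<^sup>+x. ennreal ((h n x)\<^sup>2) \<partial>lborel)"
    by (intro nn_integral_liminf) measurable
  also have "\<dots> \<le> 1"
  proof -
    have "(\<integral>\<^sup>+x. ennreal ((h n x)\<^sup>2) \<partial>lborel) \<le> 1" for n
      using h[of n] by (subst nn_integral_eq_integral) auto
    then show ?thesis by (intro Liminf_le) (auto simp: eventually_frequently)
  qed
  finally have le1: "(\<integral>\<^sup>+x. ennreal ((\<phi> x)\<^sup>2) \<partial>lborel) \<le> 1" .
  then have sq: "integrable lborel (\<lambda>x. (\<phi> x)\<^sup>2)"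
    by (intro integrableI_nonneg) (auto intro: le_less_trans)
  then have "(LINT x|lborel. (\<phi> x)\<^sup>2) \<le> 1"
    using le1 by (subst (asm) nn_integral_eq_integral) auto
  moreover have "\<nu> A = (LINT x:A|lborel. \<phi> x)" if "A \<in> sets borel" for A
    using int[of "indicator A" 1] that signed_integral_indicator[OF \<nu> that]
    by (simp add: set_lebesgue_integral_def mult.commute)
  ultimately show ?thesis
    using \<phi> sq by (intro exI[of _ \<phi>]) (auto simp: signed_density_def square_integrable_def L2_norm_def)
qed

section \<open>The refinement step\<close>

text \<open>
  The functional \<open>F \<mapsto> \<Sum>\<^sub>k c\<^sub>n(k) F(k)\<close>.  Each step peels off the finest scale of
  \<open>\<mu>\<^sub>n\<close>, whereas \<^term>\<open>mu_seq\<close> peels off the coarsest.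
\<close>

primrec cascade :: "('a::comm_ring_1 \<Rightarrow> real) \<Rightarrow> 'a set \<Rightarrow> 'a \<Rightarrow> nat \<Rightarrow> ('a \<Rightarrow> real) \<Rightarrow> real" where
  "cascade p S m 0 F = F 0"
| "cascade p S m (Suc n) F = cascade p S m n (\<lambda>j. \<Sum>i\<in>S. p i * F (m * j + i))"

text \<open>Exhibits the functional as a finite combination of point evaluations; \<open>d\<close>
  collects the pairs with the same value of \<open>m * x + i\<close>.\<close>

lemma cascade_finite_sum:
  "\<exists>X c. finite X \<and> (\<forall>F. cascade p S m n F = (\<Sum>x\<in>X. c x * F x))" if "finite S"
proof (induction n)
  case 0
  show ?case by (intro exI[of _ "{0}"] exI[of _ "\<lambda>_. 1"]) simp
next
  case (Suc n)
  then obtain X c where X: "finite X" and c: "\<And>F. cascade p S m n F = (\<Sum>x\<in>X. c x * F x)"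
    by blast
  define h where "h = (\<lambda>(x, i). m * x + i)"
  define d where "d z = (\<Sum>t\<in>{t \<in> X \<times> S. h t = z}. c (fst t) * p (snd t))" for z
  have "cascade p S m (Suc n) F = (\<Sum>z\<in>h ` (X \<times> S). d z * F z)" for F
  proof -
    have "cascade p S m (Suc n) F = (\<Sum>t\<in>X \<times> S. c (fst t) * p (snd t) * F (h t))"
      by (simp add: c sum_distrib_left sum.cartesian_product h_def case_prod_unfold mult.assoc)
    also have "\<dots> = (\<Sum>z\<in>h ` (X \<times> S). \<Sum>t\<in>{t \<in> X \<times> S. h t = z}. c (fst t) * p (snd t) * F (h t))"
      using X that by (intro sum.image_gen) auto
    also have "\<dots> = (\<Sum>z\<in>h ` (X \<times> S). d z * F z)"
      unfolding d_def sum_distrib_right by (intro sum.cong refl) auto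
    finally show ?thesis .
  qed
  moreover have "finite (h ` (X \<times> S))" using X that by simp
  ultimately show ?case by blast
qed

text \<open>The functional evaluates \<open>F\<close> at base-m expansions with digits in
  \<open>S\<close>. The recursion splits off the units digit; here the leading digit, of weight
  \<open>m ^ n\<close>, is split off instead, as in the recursion of \<open>mu_seq\<close>.\<close>

lemma cascade_Suc_left:
  "cascade p S m (Suc n) F = (\<Sum>j\<in>S. p j * cascade p S m n (\<lambda>k. F (m ^ n * j + k)))"
proof (induction n arbitrary: F)
  case 0
  show ?case by simp
next
  case (Suc n)
  have "cascade p S m (Suc (Suc n)) F =
      cascade p S m (Suc n) (\<lambda>j. \<Sum>i\<in>S. p i * F (m * j + i))"
    by simp
  also have "\<dots> = (\<Sum>j\<in>S. p j * cascade p S m n (\<lambda>k. \<Sum>i\<in>S. p i * F (m * (m ^ n * j + k) + i)))"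
    by (rule Suc.IH)
  also have "\<dots> = (\<Sum>j\<in>S. p j * cascade p S m (Suc n) (\<lambda>k. F (m ^ Suc n * j + k)))"
    by (simp add: algebra_simps)
  finally show ?case .
qed

section \<open>The measures as cascades and their quadratic bound\<close>

text \<open>Convolution adds j / m to the contracted atom k / m^(n+2), giving (m^(n+1) j + k) /
  m^(n+2): a new leading digit.\<close>

lemma mu_seq_eq_cascade:
  fixes m :: "'a::{real_normed_field, euclidean_space}"
  assumes S: "finite (supp_on \<Gamma> p)" and m: "m \<noteq> 0" and A: "A \<in> sets borel"
  shows "mu_seq \<Gamma> m p (Suc n) A =
    cascade p (supp_on \<Gamma> p) m (Suc n) (\<lambda>k. indicator A (k / m ^ Suc n))"
  using A
proof (induction n arbitrary: A)
  case 0
  show ?case by (simp add: mu_one_def dirac_def)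
next
  case (Suc n)
  let ?S = "supp_on \<Gamma> p"
  define f where "f x = push_forward (\<lambda>x. x / m) (mu_seq \<Gamma> m p (Suc n)) {y. x + y \<in> A}" for x
  have f: "f x = cascade p ?S m (Suc n) (\<lambda>k. indicator A (x + k / m ^ Suc n / m))" for x
  proof -
    \<comment> \<open>The induction hypothesis covers Borel sets only, so the preimage of
      \<open>A\<close> must be shown to be Borel.\<close>
    have "(\<lambda>z. x + z / m) \<in> borel_measurable borel"
      by (intro borel_measurable_continuous_onI continuous_intros) (simp add: m)
    then have "(\<lambda>z. x + z / m) -` A \<in> sets borel"
      using measurable_sets[of "\<lambda>z. x + z / m" borel borel A] Suc.prems by simp
    moreover have "(\<lambda>z. z / m) -` {y. x + y \<in> A} = (\<lambda>z. x + z / m) -` A" by auto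
    ultimately show ?thesis
      unfolding f_def push_forward_def by (simp add: Suc.IH indicator_def del: cascade.simps)
  qed
  obtain X c where "finite X" and c: "\<And>F. cascade p ?S m (Suc n) F = (\<Sum>x\<in>X. c x * F x)"
    using cascade_finite_sum[OF S] by blast
  have "f \<in> borel_measurable borel"
    unfolding f c
  proof (intro borel_measurable_sum borel_measurable_times borel_measurable_const)
    fix z
    have "(\<lambda>x. x + z / m ^ Suc n / m) \<in> borel_measurable borel" by simp
    then show "(\<lambda>x. indicat_real A (x + z / m ^ Suc n / m)) \<in> borel_measurable borel"
      using borel_measurable_indicator[OF Suc.prems] by (rule measurable_compose)
  qed
  then have "signed_integral (mu_one \<Gamma> m p) f = (\<Sum>k\<in>?S. p k * f (k / m))"
    by (intro signed_integral_discrete[OF S]) (auto simp: mu_one_def dirac_def)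
  then have "mu_seq \<Gamma> m p (Suc (Suc n)) A = (\<Sum>j\<in>?S. p j * f (j / m))"
    by (simp add: signed_convolution_def f_def[abs_def])
  also have "\<dots> = (\<Sum>j\<in>?S. p j * cascade p ?S m (Suc n)
      (\<lambda>k. indicator A ((m ^ Suc n * j + k) / m ^ Suc (Suc n))))"
    using m by (simp add: f add_divide_distrib mult.commute del: cascade.simps)
  also have "\<dots> = cascade p ?S m (Suc (Suc n)) (\<lambda>k. indicator A (k / m ^ Suc (Suc n)))"
    by (rule cascade_Suc_left[symmetric])
  finally show ?case .
qed

lemma signed_integral_mu_seq:
  fixes m :: "'a::{real_normed_field, euclidean_space}"
  assumes S: "finite (supp_on \<Gamma> p)" and m: "m \<noteq> 0" and f: "f \<in> borel_measurable borel"
  shows "signed_integral (mu_seq \<Gamma> m p (Suc n)) f =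
    cascade p (supp_on \<Gamma> p) m (Suc n) (\<lambda>k. f (k / m ^ Suc n))"
proof -
  obtain X c where X: "finite X"
    and c: "\<And>F. cascade p (supp_on \<Gamma> p) m (Suc n) F = (\<Sum>x\<in>X. c x * F x)"
    using cascade_finite_sum[OF S] by blast
  show ?thesis
    unfolding c by (intro signed_integral_discrete[OF X f]) (simp only: mu_seq_eq_cascade[OF S m] c)
qed

text \<open>
  Bessel's inequality: by orthonormality the functions \<open>k \<mapsto> \<surd>2 p (k - m j)\<close>, \<open>j \<in> \<Gamma>\<close>, form
  an orthonormal system in \<open>\<ell>\<^sup>2(\<Gamma>)\<close>.
\<close>

lemma cascade_step_bessel:
  fixes m :: "'a::real_normed_field"
  assumes \<Gamma>: "\<And>x y. x \<in> \<Gamma> \<Longrightarrow> y \<in> \<Gamma> \<Longrightarrow> x + y \<in> \<Gamma>" "\<And>x y. x \<in> \<Gamma> \<Longrightarrow> y \<in> \<Gamma> \<Longrightarrow> x - y \<in> \<Gamma>"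
      "\<And>x. x \<in> \<Gamma> \<Longrightarrow> m * x \<in> \<Gamma>"
    and m: "m \<noteq> 0" and S: "finite (supp_on \<Gamma> p)" and orth: "orthonormality \<Gamma> m p"
    and K: "finite K" "K \<subseteq> \<Gamma>" and F: "\<And>k. k \<in> \<Gamma> \<Longrightarrow> k \<notin> K \<Longrightarrow> F k = 0"
    and G: "G = (\<lambda>j. \<Sum>i\<in>supp_on \<Gamma> p. p i * F (m * j + i))"
  obtains J where "finite J" "J \<subseteq> \<Gamma>" "\<And>j. j \<in> \<Gamma> \<Longrightarrow> j \<notin> J \<Longrightarrow> G j = 0"
    "2 * (\<Sum>j\<in>J. (G j)\<^sup>2) \<le> (\<Sum>k\<in>K. (F k)\<^sup>2)"
proof -
  let ?S = "supp_on \<Gamma> p"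
  have S\<Gamma>: "?S \<subseteq> \<Gamma>" and p0: "\<And>k. k \<in> \<Gamma> \<Longrightarrow> k \<notin> ?S \<Longrightarrow> p k = 0"
    by (auto simp: supp_on_def)
  have step\<Gamma>: "m * j + i \<in> \<Gamma>" if "j \<in> \<Gamma>" "i \<in> ?S" for i j
    using \<Gamma>(1)[OF \<Gamma>(3)[OF that(1)]] S\<Gamma> that(2) by blast
  \<comment> \<open>If \<open>m * j + i\<close> hits \<open>K\<close>, then j is (k - i) / m for
    some k in \<open>K\<close>; all other lattice points j give \<open>G j = 0\<close>.\<close>
  define J where "J = (\<lambda>(k, i). (k - i) / m) ` (K \<times> ?S) \<inter> \<Gamma>"
  have J: "finite J" "J \<subseteq> \<Gamma>" using K S by (auto simp: J_def)
  have G0: "G j = 0" if "j \<in> \<Gamma>" "j \<notin> J" for j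
    unfolding G
  proof (intro sum.neutral ballI)
    fix i assume i: "i \<in> ?S"
    have "m * j + i \<notin> K"
    proof
      assume "m * j + i \<in> K"
      moreover have "j = (m * j + i - i) / m" using m by simp
      ultimately have "j \<in> J" using i that unfolding J_def by force
      with that show False by simp
    qed
    moreover have "m * j + i \<in> \<Gamma>" by (rule step\<Gamma>[OF that(1) i])
    ultimately show "p i * F (m * j + i) = 0" using F by simp
  qed
  \<comment> \<open>A finite window containing \<open>K\<close> and every translate of the support
    by \<open>m * j\<close> with j in \<open>J\<close>, on which the sums over \<Gamma> can be
    computed.\<close>
  define W where "W = K \<union> (\<Union>j\<in>J. (\<lambda>i. m * j + i) ` ?S)"
  have W: "finite W" "W \<subseteq> \<Gamma>" using K J S step\<Gamma> by (auto simp: W_def)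
  have shift: "(\<Sum>i\<in>?S. p i * H (m * j + i)) = (\<Sum>k\<in>W. p (k - m * j) * H k)" if "j \<in> J" for j H
  proof -
    have "(\<Sum>i\<in>?S. p i * H (m * j + i)) = (\<Sum>k\<in>(\<lambda>i. m * j + i) ` ?S. p (k - m * j) * H k)"
      by (subst sum.reindex) (auto simp: inj_on_def)
    also have "\<dots> = (\<Sum>k\<in>W. p (k - m * j) * H k)"
    proof (intro sum.mono_neutral_left ballI)
      show "(\<lambda>i. m * j + i) ` ?S \<subseteq> W" using that by (auto simp: W_def)
      fix k assume k: "k \<in> W - (\<lambda>i. m * j + i) ` ?S"
      then have "k - m * j \<notin> ?S" by (metis DiffD2 add.commute diff_add_cancel imageI)
      moreover have "k - m * j \<in> \<Gamma>" using \<Gamma>(2)[of k "m * j"] \<Gamma>(3)[of j] k W(2) J(2) that by blast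
      ultimately show "p (k - m * j) * H k = 0" using p0 by simp
    qed (use W in auto)
    finally show ?thesis .
  qed
  \<comment> \<open>Orthonormality at the lattice point \<open>j - j'\<close>.\<close>
  have gram: "(\<Sum>k\<in>W. p (k - m * j) * p (k - m * j')) = (if j = j' then 1 / 2 else 0)"
    if "j \<in> J" "j' \<in> J" for j j'
  proof -
    have "(\<Sum>k\<in>W. p (k - m * j) * p (k - m * j')) = (\<Sum>i\<in>?S. p i * p (m * j + i - m * j'))"
      using shift[OF that(1), of "\<lambda>k. p (k - m * j')"] by simp
    also have "\<dots> = (\<Sum>i\<in>?S. p i * p (i + m * (j - j')))"
      by (simp add: algebra_simps)
    also have "\<dots> = (if j - j' = 0 then 1 / 2 else 0)"
    proof -
      have "j - j' \<in> \<Gamma>" using \<Gamma>(2) that J(2) by blast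
      then show ?thesis using orth unfolding orthonormality_def by blast
    qed
    finally show ?thesis by simp
  qed
  \<comment> \<open>\<open>2 * V k\<close> is the orthogonal projection of \<open>F\<close> onto the
    span of the translates of p: the squared normalization factor is 2. Expanding the squared
    distance from \<open>F\<close> to it gives the inequality.\<close>
  define V where "V k = (\<Sum>j\<in>J. G j * p (k - m * j))" for k
  have FV: "(\<Sum>k\<in>W. F k * V k) = (\<Sum>j\<in>J. (G j)\<^sup>2)"
  proof -
    have "(\<Sum>k\<in>W. F k * V k) = (\<Sum>j\<in>J. G j * (\<Sum>k\<in>W. p (k - m * j) * F k))"
      unfolding V_def sum_distrib_left by (subst sum.swap) (simp add: mult_ac)
    also have "\<dots> = (\<Sum>j\<in>J. (G j)\<^sup>2)"
      by (intro sum.cong refl) (simp add: shift[symmetric] power2_eq_square, simp add: G)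
    finally show ?thesis .
  qed
  have VV: "(\<Sum>k\<in>W. (V k)\<^sup>2) = (\<Sum>j\<in>J. (G j)\<^sup>2) / 2"
  proof -
    have "(\<Sum>k\<in>W. (V k)\<^sup>2) =
        (\<Sum>k\<in>W. \<Sum>j\<in>J. \<Sum>j'\<in>J. G j * (G j' * (p (k - m * j) * p (k - m * j'))))"
      unfolding V_def power2_eq_square sum_product by (simp add: mult_ac)
    also have "\<dots> = (\<Sum>j\<in>J. \<Sum>j'\<in>J. G j * (G j' * (\<Sum>k\<in>W. p (k - m * j) * p (k - m * j'))))"
      unfolding sum_distrib_left by (subst sum.swap) (subst (2) sum.swap, rule refl)
    also have "\<dots> = (\<Sum>j\<in>J. \<Sum>j'\<in>J. if j' = j then (G j)\<^sup>2 / 2 else 0)"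
      by (intro sum.cong refl) (simp add: gram power2_eq_square)
    also have "\<dots> = (\<Sum>j\<in>J. (G j)\<^sup>2) / 2"
      using J by (simp add: sum_divide_distrib)
    finally show ?thesis .
  qed
  have "0 \<le> (\<Sum>k\<in>W. (F k - 2 * V k)\<^sup>2)" by (intro sum_nonneg) simp
  also have "\<dots> = (\<Sum>k\<in>W. (F k)\<^sup>2) - 4 * (\<Sum>k\<in>W. F k * V k) + 4 * (\<Sum>k\<in>W. (V k)\<^sup>2)"
    by (simp add: power2_diff power_mult_distrib sum.distrib sum_subtractf sum_distrib_left mult_ac)
  also have "(\<Sum>k\<in>W. (F k)\<^sup>2) = (\<Sum>k\<in>K. (F k)\<^sup>2)"
  proof (rule sum.mono_neutral_right[OF W(1)])
    show "K \<subseteq> W" by (simp add: W_def)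
    show "\<forall>k\<in>W - K. (F k)\<^sup>2 = 0" using W(2) F by auto
  qed
  finally have "2 * (\<Sum>j\<in>J. (G j)\<^sup>2) \<le> (\<Sum>k\<in>K. (F k)\<^sup>2)" by (simp add: FV VV)
  then show thesis using that[OF J G0] by blast
qed

text \<open>Each step back replaces \<open>F\<close> by \<open>G\<close> and gains a factor 1/2 by
  Bessel's inequality. At the end only the value at 0 remains, which is one term of the sum or
  zero.\<close>

lemma cascade_bound:
  fixes m :: "'a::real_normed_field"
  assumes \<Gamma>: "0 \<in> \<Gamma>" "\<And>x y. x \<in> \<Gamma> \<Longrightarrow> y \<in> \<Gamma> \<Longrightarrow> x + y \<in> \<Gamma>"
      "\<And>x y. x \<in> \<Gamma> \<Longrightarrow> y \<in> \<Gamma> \<Longrightarrow> x - y \<in> \<Gamma>" "\<And>x. x \<in> \<Gamma> \<Longrightarrow> m * x \<in> \<Gamma>"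
    and m: "m \<noteq> 0" and S: "finite (supp_on \<Gamma> p)" and orth: "orthonormality \<Gamma> m p"
    and K: "finite K" "K \<subseteq> \<Gamma>" and F: "\<And>k. k \<in> \<Gamma> \<Longrightarrow> k \<notin> K \<Longrightarrow> F k = 0"
  shows "(cascade p (supp_on \<Gamma> p) m n F)\<^sup>2 \<le> (1 / 2) ^ n * (\<Sum>k\<in>K. (F k)\<^sup>2)"
  using K F
proof (induction n arbitrary: F K)
  case 0
  show ?case
  proof (cases "0 \<in> K")
    case True
    then show ?thesis using member_le_sum[of 0 K "\<lambda>k. (F k)\<^sup>2"] 0 by simp
  next
    case False
    then show ?thesis using 0 \<Gamma>(1) by (simp add: sum_nonneg)
  qed
next
  case (Suc n)
  define G where "G = (\<lambda>j. \<Sum>i\<in>supp_on \<Gamma> p. p i * F (m * j + i))"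
  obtain J where J: "finite J" "J \<subseteq> \<Gamma>" "\<And>j. j \<in> \<Gamma> \<Longrightarrow> j \<notin> J \<Longrightarrow> G j = 0"
    "2 * (\<Sum>j\<in>J. (G j)\<^sup>2) \<le> (\<Sum>k\<in>K. (F k)\<^sup>2)"
    by (rule cascade_step_bessel[OF \<Gamma>(2-4) m S orth Suc.prems G_def]; (assumption | rule that))
  have "(cascade p (supp_on \<Gamma> p) m (Suc n) F)\<^sup>2 = (cascade p (supp_on \<Gamma> p) m n G)\<^sup>2"
    by (simp add: G_def)
  also have "\<dots> \<le> (1 / 2) ^ n * (\<Sum>j\<in>J. (G j)\<^sup>2)"
    by (rule Suc.IH[OF J(1-3)])
  also have "\<dots> \<le> (1 / 2) ^ n * ((\<Sum>k\<in>K. (F k)\<^sup>2) / 2)"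
    using J(4) by (intro mult_left_mono) auto
  finally show ?case by simp
qed

section \<open>Riemann sums over the integer lattice\<close>

text \<open>A common description of \<open>\<int>\<close> and
  \<open>gaussian_integers\<close>.\<close>

definition integer_points :: "'a::euclidean_space set" where
  "integer_points = {x. \<forall>b\<in>Basis. x \<bullet> b \<in> \<int>}"

lemma integer_points_0: "0 \<in> integer_points"
  and integer_points_add: "x \<in> integer_points \<Longrightarrow> y \<in> integer_points \<Longrightarrow> x + y \<in> integer_points"
  and integer_points_diff: "x \<in> integer_points \<Longrightarrow> y \<in> integer_points \<Longrightarrow> x - y \<in> integer_points"
  by (auto simp: integer_points_def inner_add_left inner_diff_left)

lemma finite_integer_points_cball:
  "finite (integer_points \<inter> cball (0::'a::euclidean_space) B)"
proof -
  let ?f = "\<lambda>x::'a. restrict (\<lambda>b. x \<bullet> b) Basis"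
  have "finite (PiE Basis (\<lambda>_::'a. {k \<in> \<int>. \<bar>k\<bar> \<le> B}))"
    by (intro finite_PiE finite_abs_int_segment) simp
  moreover have "?f ` (integer_points \<inter> cball 0 B) \<subseteq> PiE Basis (\<lambda>_. {k \<in> \<int>. \<bar>k\<bar> \<le> B})"
    by (auto simp: integer_points_def intro: order_trans[OF Basis_le_norm])
  ultimately have "finite (?f ` (integer_points \<inter> cball 0 B))" by (rule finite_subset[rotated])
  moreover have "inj_on ?f (integer_points \<inter> cball 0 B)"
  proof (rule inj_onI)
    fix x y assume "?f x = ?f y"
    then have "x \<bullet> b = y \<bullet> b" if "b \<in> Basis" for b
      using that by (metis restrict_apply')
    then show "x = y" by (rule euclidean_eqI)
  qed
  ultimately show ?thesis by (rule finite_imageD)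
qed

lemma integer_points_boxes_disjoint:
  fixes k k' x :: "'a::euclidean_space"
  assumes k: "k \<in> integer_points" "k' \<in> integer_points" and \<delta>: "\<delta> > 0"
    and x: "x \<in> box (\<delta> *\<^sub>R k) (\<delta> *\<^sub>R (k + One))" "x \<in> box (\<delta> *\<^sub>R k') (\<delta> *\<^sub>R (k' + One))"
  shows "k = k'"
proof (rule euclidean_eqI)
  fix b :: 'a assume b: "b \<in> Basis"
  then have "\<delta> * (k \<bullet> b) < x \<bullet> b" "x \<bullet> b < \<delta> * (k \<bullet> b + 1)"
    "\<delta> * (k' \<bullet> b) < x \<bullet> b" "x \<bullet> b < \<delta> * (k' \<bullet> b + 1)"
    using x by (auto simp: mem_box inner_add_left)
  then have "\<delta> * (k \<bullet> b) < \<delta> * (k' \<bullet> b + 1)" "\<delta> * (k' \<bullet> b) < \<delta> * (k \<bullet> b + 1)"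
    by linarith+
  then have "k \<bullet> b < k' \<bullet> b + 1" "k' \<bullet> b < k \<bullet> b + 1" using \<delta> by auto
  moreover have "k \<bullet> b \<in> \<int>" "k' \<bullet> b \<in> \<int>" using k b by (auto simp: integer_points_def)
  ultimately show "k \<bullet> b = k' \<bullet> b" by (auto elim!: Ints_cases)
qed

lemma measure_grid_box:
  fixes k :: "'a::euclidean_space"
  assumes "\<delta> > 0"
  shows "measure lborel (box (\<delta> *\<^sub>R k) (\<delta> *\<^sub>R (k + One))) = \<delta> ^ DIM('a)"
  using assms by (subst measure_lborel_box_eq) (auto simp: algebra_simps)

text \<open>Only an upper estimate is needed, so disjoint open boxes suffice: on each box the corner
  value exceeds \<open>g\<close> by at most \<epsilon>, and points in no box cost nothing because
  \<open>g\<close> is nonnegative.\<close>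

lemma integer_points_riemann_sum:
  fixes g :: "'a::euclidean_space \<Rightarrow> real"
  assumes g: "continuous_on UNIV g" "\<And>x. 0 \<le> g x" and supp: "\<And>x. g x \<noteq> 0 \<Longrightarrow> norm x \<le> R"
    and \<epsilon>: "\<epsilon> > 0"
  obtains d where "d > 0" "\<And>\<delta> K. 0 < \<delta> \<Longrightarrow> \<delta> < d \<Longrightarrow> finite K \<Longrightarrow> K \<subseteq> integer_points \<Longrightarrow>
    \<delta> ^ DIM('a) * (\<Sum>k\<in>K. g (\<delta> *\<^sub>R k)) \<le>
      (LINT x|lborel. g x) + \<epsilon> * measure lborel (cball (0::'a) (R + 1))"
proof -
  have "uniformly_continuous_on (cball 0 (R + 1)) g"
    using g(1) by (intro compact_uniformly_continuous continuous_on_subset[OF g(1)]) auto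
  then obtain d0 where d0: "d0 > 0" "\<And>x y. x \<in> cball 0 (R + 1) \<Longrightarrow> y \<in> cball 0 (R + 1) \<Longrightarrow>
      dist x y < d0 \<Longrightarrow> dist (g x) (g y) < \<epsilon>"
    using \<epsilon> unfolding uniformly_continuous_on_def by metis
  \<comment> \<open>A box of side \<delta> has l1 diameter at most DIM * \<delta>. The bound 1 keeps
    it inside the ball of radius \<open>R + 1\<close> when its corner is in the support;
    \<open>d0\<close> gives uniform continuity.\<close>
  define d where "d = min 1 d0 / DIM('a)"
  have d: "d > 0" using d0 by (simp add: d_def)
  have [measurable]: "g \<in> borel_measurable borel"
    using g(1) by (rule borel_measurable_continuous_onI)
  have ind: "integrable lborel (indicat_real (cball (0::'a) (R + 1)))"
    using emeasure_bounded_finite[OF bounded_cball, of "0::'a" "R + 1"]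
    by (intro integrable_real_indicator) auto
  have "bounded (g ` cball 0 (R + 1))"
    by (intro compact_imp_bounded compact_continuous_image continuous_on_subset[OF g(1)]) auto
  then obtain M where "\<forall>y\<in>g ` cball 0 (R + 1). norm y \<le> M"
    unfolding bounded_iff ..
  then have M: "\<bar>g x\<bar> \<le> M" if "x \<in> cball 0 (R + 1)" for x
    using that by auto
  have "\<bar>g x\<bar> \<le> M * indicator (cball 0 (R + 1)) x" for x
    using M[of x] supp[of x] by (cases "g x = 0") (auto simp: indicator_def)
  then have gint: "integrable lborel g"
    by (intro Bochner_Integration.integrable_bound[OF integrable_mult_right[OF ind, of M]])
      (auto intro: order_trans[OF _ abs_ge_self])
  show ?thesis
  proof (rule that[OF d])
    fix \<delta> :: real and K :: "'a set"
    assume \<delta>: "0 < \<delta>" "\<delta> < d" and K: "finite K" "K \<subseteq> integer_points"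
    let ?B = "\<lambda>k. box (\<delta> *\<^sub>R k) (\<delta> *\<^sub>R (k + One)) :: 'a set"
    have near: "norm (x - \<delta> *\<^sub>R k) < min 1 d0" if "x \<in> ?B k" for x k
    proof -
      have "norm (x - \<delta> *\<^sub>R k) \<le> (\<Sum>b\<in>Basis. \<bar>(x - \<delta> *\<^sub>R k) \<bullet> b\<bar>)" by (rule norm_le_l1)
      also have "\<dots> \<le> (\<Sum>b\<in>(Basis::'a set). \<delta>)"
        using that by (intro sum_mono) (force simp: mem_box algebra_simps)
      also have "\<dots> < min 1 d0" using \<delta>(2) by (simp add: d_def field_simps)
      finally show ?thesis .
    qed
    have one: "g (\<delta> *\<^sub>R k) \<le> g x + \<epsilon> * indicator (cball 0 (R + 1)) x" if "x \<in> ?B k" for x k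
    proof (cases "g (\<delta> *\<^sub>R k) = 0")
      case True
      then show ?thesis using g(2)[of x] \<epsilon> by (simp add: indicator_def)
    next
      case False
      then have R: "norm (\<delta> *\<^sub>R k) \<le> R" by (rule supp)
      then have "norm x \<le> R + 1"
        using near[OF that] norm_triangle_sub[of x "\<delta> *\<^sub>R k"] by linarith
      then have "dist (g (\<delta> *\<^sub>R k)) (g x) < \<epsilon>"
        using R near[OF that] by (intro d0(2)) (auto simp: dist_norm norm_minus_commute)
      then show ?thesis using \<open>norm x \<le> R + 1\<close> by (simp add: dist_real_def)
    qed
    have pointwise: "(\<Sum>k\<in>K. g (\<delta> *\<^sub>R k) * indicator (?B k) x) \<le>
        g x + \<epsilon> * indicator (cball 0 (R + 1)) x" for x
    proof (cases "\<exists>k\<in>K. x \<in> ?B k")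
      case True
      then obtain k where k: "k \<in> K" "x \<in> ?B k" by blast
      have "(\<Sum>k\<in>K. g (\<delta> *\<^sub>R k) * indicator (?B k) x) = (\<Sum>k\<in>{k}. g (\<delta> *\<^sub>R k) * indicator (?B k) x)"
      proof (rule sum.mono_neutral_right[OF K(1)])
        show "\<forall>k'\<in>K - {k}. g (\<delta> *\<^sub>R k') * indicator (?B k') x = 0"
        proof
          fix k' assume k': "k' \<in> K - {k}"
          then have "x \<notin> ?B k'"
            using integer_points_boxes_disjoint[of k k' \<delta> x] k K(2) \<delta>(1) by blast
          then show "g (\<delta> *\<^sub>R k') * indicator (?B k') x = 0" by simp
        qed
      qed (use k in auto)
      also have "\<dots> = g (\<delta> *\<^sub>R k)" using k by simp
      finally show ?thesis using one[OF k(2)] by simp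
    next
      case False
      then have "(\<Sum>k\<in>K. g (\<delta> *\<^sub>R k) * indicator (?B k) x) = 0"
        by (intro sum.neutral) (auto simp: indicator_def)
      then show ?thesis using g(2)[of x] \<epsilon> by (simp add: indicator_def)
    qed
    have Bint: "integrable lborel (indicat_real (?B k))" for k
      using emeasure_bounded_finite[OF bounded_box, of "\<delta> *\<^sub>R k" "\<delta> *\<^sub>R (k + One)"]
      by (intro integrable_real_indicator) auto
    have "\<delta> ^ DIM('a) * (\<Sum>k\<in>K. g (\<delta> *\<^sub>R k)) = (\<Sum>k\<in>K. g (\<delta> *\<^sub>R k) * measure lborel (?B k))"
      by (simp only: measure_grid_box[OF \<delta>(1)] sum_distrib_left mult.commute)
    also have "\<dots> = (LINT x|lborel. (\<Sum>k\<in>K. g (\<delta> *\<^sub>R k) * indicator (?B k) x))"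
      using Bint by (subst Bochner_Integration.integral_sum) auto
    also have "\<dots> \<le> (LINT x|lborel. g x + \<epsilon> * indicator (cball 0 (R + 1)) x)"
      using Bint gint ind pointwise by (intro integral_mono) auto
    also have "\<dots> = (LINT x|lborel. g x) + \<epsilon> * measure lborel (cball (0::'a) (R + 1))"
      using gint ind by simp
    finally show "\<delta> ^ DIM('a) * (\<Sum>k\<in>K. g (\<delta> *\<^sub>R k)) \<le>
      (LINT x|lborel. g x) + \<epsilon> * measure lborel (cball (0::'a) (R + 1))" .
  qed
qed

section \<open>Passage to the weak limit\<close>

text \<open>
  Since \<open>m\<^sup>2 = s u\<close> with a unit \<open>u\<close> of \<open>\<Gamma>\<close>, the set \<open>m\<^bsup>-2l\<^esup> \<Gamma>\<close> is the cubic grid \<open>s\<^bsup>-l\<^esup> \<Gamma>\<close>.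
  This is why only the even terms of the sequence are used.
\<close>

lemma weak_limit_L2_bounded:
  fixes m u :: "'a::{real_normed_field, euclidean_space}" and \<nu> :: "'a set \<Rightarrow> real"
  assumes m\<Gamma>: "\<And>x. x \<in> integer_points \<Longrightarrow> m * x \<in> integer_points"
    and u\<Gamma>: "\<And>x. x \<in> integer_points \<Longrightarrow> x / u \<in> integer_points"
    and m: "m\<^sup>2 = of_real s * u" and u: "norm u = 1" and s: "s > 1" "s ^ DIM('a) = 4"
    and S: "finite (supp_on integer_points p)" and orth: "orthonormality integer_points m p"
    and lim: "weak_limit (mu_seq integer_points m p) \<nu>"
  shows "L2_bounded \<nu>"
  unfolding L2_bounded_def
proof (intro allI impI)
  fix f :: "'a \<Rightarrow> real" assume f: "continuous_on UNIV f" and "bounded {x. f x \<noteq> 0}"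
  then obtain R where R: "\<And>x. f x \<noteq> 0 \<Longrightarrow> norm x \<le> R" by (auto simp: bounded_iff)
  have m0: "m \<noteq> 0" using m u s by auto
  have u0: "u \<noteq> 0" using u by auto
  let ?\<Gamma> = "integer_points :: 'a set"
  let ?c = "\<lambda>n. signed_integral (mu_seq ?\<Gamma> m p n) f"
  let ?V = "measure lborel (cball (0::'a) (R + 1))"
  have u\<Gamma>l: "x / u ^ l \<in> ?\<Gamma>" if "x \<in> ?\<Gamma>" for x l
  proof (induction l)
    case (Suc l)
    show ?case using u\<Gamma>[OF Suc.IH] by (simp add: mult.commute)
  qed (simp add: that)
  have grid: "k / m ^ (2 * l) = (1 / s) ^ l *\<^sub>R (k / u ^ l)" for k l
  proof -
    have "m ^ (2 * l) = of_real (s ^ l) * u ^ l"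
      unfolding power_mult m power_mult_distrib by simp
    then show ?thesis by (simp add: scaleR_conv_of_real power_divide)
  qed
  have bound: "(?c (2 * Suc l))\<^sup>2 \<le> ((1 / s) ^ Suc l) ^ DIM('a) *
      (\<Sum>k\<in>?\<Gamma> \<inter> cball 0 (R * s ^ Suc l). (f ((1 / s) ^ Suc l *\<^sub>R k))\<^sup>2)" for l
  proof -
    \<comment> \<open>The indices 2, 4, 6, ... avoid the dummy term at 0; the \<open>Suc\<close>
      form matches \<open>signed_integral_mu_seq\<close>.\<close>
    define n where "n = Suc (2 * l + 1)"
    have n: "n = 2 * Suc l" by (simp add: n_def)
    \<comment> \<open>As u has norm 1, a lattice point k outside this ball is scaled to norm greater
      than \<open>R\<close>, off the support of \<open>f\<close>.\<close>
    define K where "K = ?\<Gamma> \<inter> cball 0 (R * s ^ Suc l)"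
    have K: "finite K" "K \<subseteq> ?\<Gamma>" unfolding K_def using finite_integer_points_cball by auto
    define F where "F k = f (k / m ^ n)" for k
    have F: "F k = f ((1 / s) ^ Suc l *\<^sub>R (k / u ^ Suc l))" for k
      unfolding F_def n grid ..
    have F0: "F k = 0" if "k \<in> ?\<Gamma>" "k \<notin> K" for k
    proof (rule ccontr)
      assume "F k \<noteq> 0"
      then have "norm ((1 / s) ^ Suc l *\<^sub>R (k / u ^ Suc l)) \<le> R" unfolding F by (rule R)
      then have "norm k / s ^ Suc l \<le> R"
        using s u by (simp add: norm_divide norm_power norm_mult power_divide)
      then have "norm k \<le> R * s ^ Suc l" using s by (simp add: field_simps)
      then show False using that by (simp add: K_def)
    qed
    have "f \<in> borel_measurable borel" using f by (rule borel_measurable_continuous_onI)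
    then have "?c n = cascade p (supp_on ?\<Gamma> p) m n F"
      unfolding n_def F_def by (intro signed_integral_mu_seq[OF S m0])
    then have "(?c n)\<^sup>2 \<le> (1 / 2) ^ n * (\<Sum>k\<in>K. (F k)\<^sup>2)"
      using cascade_bound[OF integer_points_0 integer_points_add integer_points_diff m\<Gamma> m0 S orth K F0]
      by simp
    also have "(\<Sum>k\<in>K. (F k)\<^sup>2) = (\<Sum>k\<in>(\<lambda>k. k / u ^ Suc l) ` K. (f ((1 / s) ^ Suc l *\<^sub>R k))\<^sup>2)"
      using u0 by (subst sum.reindex) (auto simp: inj_on_def F)
    \<comment> \<open>Division by a power of u maps \<open>K\<close> injectively into itself, since
      it preserves both the lattice and the norm.\<close>
    also have "\<dots> \<le> (\<Sum>k\<in>K. (f ((1 / s) ^ Suc l *\<^sub>R k))\<^sup>2)"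
    proof (rule sum_mono2[OF K(1)])
      show "(\<lambda>k. k / u ^ Suc l) ` K \<subseteq> K"
        using u\<Gamma>l[of _ "Suc l"] u by (auto simp: K_def norm_divide norm_power norm_mult simp del: power_Suc)
    qed simp
    \<comment> \<open>The factor from Bessel's inequality is exactly the volume of a grid cell,
      because \<open>s ^ DIM('a) = 4\<close>.\<close>
    also have "(1 / 2) ^ n = ((1 / s) ^ Suc l) ^ DIM('a)"
    proof -
      have "((1 / s) ^ Suc l) ^ DIM('a) = ((1 / s) ^ DIM('a)) ^ Suc l"
        by (simp only: power_mult[symmetric] mult.commute)
      also have "\<dots> = ((1 / 2)\<^sup>2) ^ Suc l" using s(2) by (simp add: power_divide)
      also have "\<dots> = (1 / 2) ^ n" by (simp only: n power_mult)
      finally show ?thesis ..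
    qed
    finally show ?thesis by (simp add: n K_def)
  qed
  have "bounded (range f)"
  proof -
    have "compact (f ` cball 0 R)"
      by (intro compact_continuous_image continuous_on_subset[OF f]) auto
    moreover have "range f \<subseteq> insert 0 (f ` cball 0 R)" using R by force
    ultimately show ?thesis by (meson bounded_insert bounded_subset compact_imp_bounded)
  qed
  then have "?c \<longlonglongrightarrow> signed_integral \<nu> f" using lim f unfolding weak_limit_def by blast
  moreover have "strict_mono (\<lambda>l. 2 * Suc l)" by (simp add: strict_mono_def)
  ultimately have clim: "(\<lambda>l. (?c (2 * Suc l))\<^sup>2) \<longlonglongrightarrow> (signed_integral \<nu> f)\<^sup>2"
    by (intro tendsto_power) (auto dest: LIMSEQ_subseq_LIMSEQ simp: o_def)
  have le: "(signed_integral \<nu> f)\<^sup>2 \<le> (LINT x|lborel. (f x)\<^sup>2) + \<epsilon> * ?V" if "\<epsilon> > 0" for \<epsilon>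
  proof -
    have cont2: "continuous_on UNIV (\<lambda>x. (f x)\<^sup>2)" by (intro continuous_intros f)
    have supp2: "norm x \<le> R" if "(f x)\<^sup>2 \<noteq> 0" for x using R[of x] that by simp
    obtain d where d: "d > 0" "\<And>\<delta> K. 0 < \<delta> \<Longrightarrow> \<delta> < d \<Longrightarrow> finite K \<Longrightarrow> K \<subseteq> ?\<Gamma> \<Longrightarrow>
      \<delta> ^ DIM('a) * (\<Sum>k\<in>K. (f (\<delta> *\<^sub>R k))\<^sup>2) \<le> (LINT x|lborel. (f x)\<^sup>2) + \<epsilon> * ?V"
      by (rule integer_points_riemann_sum[OF cont2 zero_le_power2 supp2 \<open>\<epsilon> > 0\<close>]; (assumption | rule that))
    have "(\<lambda>l. (1 / s) ^ Suc l) \<longlonglongrightarrow> 0"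
      using s by (intro LIMSEQ_Suc LIMSEQ_realpow_zero) auto
    then have "eventually (\<lambda>l. (1 / s) ^ Suc l < d) sequentially"
      using d(1) by (rule order_tendstoD)
    then have "eventually (\<lambda>l. (?c (2 * Suc l))\<^sup>2 \<le> (LINT x|lborel. (f x)\<^sup>2) + \<epsilon> * ?V) sequentially"
    proof eventually_elim
      fix l assume "(1 / s) ^ Suc l < d"
      then show "(?c (2 * Suc l))\<^sup>2 \<le> (LINT x|lborel. (f x)\<^sup>2) + \<epsilon> * ?V"
        using s by (intro order_trans[OF bound d(2)]) (auto simp: finite_integer_points_cball)
    qed
    then show ?thesis by (rule tendsto_upperbound[OF clim]) simp
  qed
  show "(signed_integral \<nu> f)\<^sup>2 \<le> (LINT x|lborel. (f x)\<^sup>2)"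
  proof (rule field_le_epsilon)
    fix e :: real assume "e > 0"
    \<comment> \<open>Adding 1 keeps the denominator positive even if the ball is empty.\<close>
    have V: "0 < ?V + 1" by (intro add_nonneg_pos) auto
    have "e * ?V \<le> e * (?V + 1)" using \<open>e > 0\<close> by (intro mult_left_mono) auto
    then have "e / (?V + 1) * ?V \<le> e" using V by (simp add: pos_divide_le_eq)
    then show "(signed_integral \<nu> f)\<^sup>2 \<le> (LINT x|lborel. (f x)\<^sup>2) + e"
      using le[of "e / (?V + 1)"] V \<open>e > 0\<close> by (smt (verit) divide_pos_pos)
  qed
qed

section \<open>The real and the Gaussian case\<close>

lemma Ints_eq_integer_points: "\<int> = (integer_points :: real set)"
  by (auto simp: integer_points_def)

lemma gaussian_integers_eq_integer_points: "gaussian_integers = integer_points"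
  by (auto simp: integer_points_def gaussian_integers_def Basis_complex_def inner_complex_def)

theorem theorem10:
  shows "(\<forall>(p :: real \<Rightarrow> real) (\<mu> :: real set \<Rightarrow> real).
            finite (supp_on \<int> p) \<longrightarrow>
            (\<Sum>k\<in>supp_on \<int> p. p k) = 1 \<longrightarrow>
            orthonormality \<int> 2 p \<longrightarrow>
            finite_signed_measure \<mu> \<longrightarrow>
            weak_limit (mu_seq \<int> 2 p) \<mu> \<longrightarrow>
            (\<exists>\<phi>. signed_density \<mu> \<phi> \<and> square_integrable \<phi> \<and> L2_norm \<phi> \<le> 1)) \<and>
         (\<forall>(p :: complex \<Rightarrow> real) (\<mu> :: complex set \<Rightarrow> real).
            finite (supp_on gaussian_integers p) \<longrightarrow>
            (\<Sum>k\<in>supp_on gaussian_integers p. p k) = 1 \<longrightarrow>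
            orthonormality gaussian_integers (1 + \<i>) p \<longrightarrow>
            finite_signed_measure \<mu> \<longrightarrow>
            weak_limit (mu_seq gaussian_integers (1 + \<i>) p) \<mu> \<longrightarrow>
            (\<exists>\<phi>. signed_density \<mu> \<phi> \<and> square_integrable \<phi> \<and> L2_norm \<phi> \<le> 1))"
proof (intro conjI allI impI)
  fix p :: "real \<Rightarrow> real" and \<mu> :: "real set \<Rightarrow> real"
  assume p: "finite (supp_on \<int> p)" "orthonormality \<int> 2 p"
    and \<mu>: "finite_signed_measure \<mu>" and lim: "weak_limit (mu_seq \<int> 2 p) \<mu>"
  \<comment> \<open>Since 2^2 = 4 * 1, take s = 4 and u = 1; in dimension one, s^1 = 4.\<close>
  have "L2_bounded \<mu>"
    using p lim unfolding Ints_eq_integer_points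
    by (intro weak_limit_L2_bounded[of 2 1 4 p \<mu>])
      (auto simp: Ints_eq_integer_points[symmetric])
  with \<mu> show "\<exists>\<phi>. signed_density \<mu> \<phi> \<and> square_integrable \<phi> \<and> L2_norm \<phi> \<le> 1"
    by (rule L2_bounded_imp_square_integrable_density)
next
  fix p :: "complex \<Rightarrow> real" and \<mu> :: "complex set \<Rightarrow> real"
  assume p: "finite (supp_on gaussian_integers p)" "orthonormality gaussian_integers (1 + \<i>) p"
    and \<mu>: "finite_signed_measure \<mu>" and lim: "weak_limit (mu_seq gaussian_integers (1 + \<i>) p) \<mu>"
  \<comment> \<open>Since \<open>(1 + \<i>)\<close> squared is \<open>2 * \<i>\<close>, take s = 2
    and u = \<open>\<i>\<close>; in dimension two, s^2 = 4.\<close>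
  have "L2_bounded \<mu>"
    using p lim unfolding gaussian_integers_eq_integer_points
  proof (intro weak_limit_L2_bounded[of "1 + \<i>" \<i> 2 p \<mu>])
    show "(1 + \<i>)\<^sup>2 = complex_of_real 2 * \<i>" by (simp add: power2_eq_square algebra_simps)
    fix x :: complex assume "x \<in> integer_points"
    then show "(1 + \<i>) * x \<in> integer_points" "x / \<i> \<in> integer_points"
      by (auto simp: gaussian_integers_eq_integer_points[symmetric] gaussian_integers_def
          Re_divide Im_divide)
  qed auto
  with \<mu> show "\<exists>\<phi>. signed_density \<mu> \<phi> \<and> square_integrable \<phi> \<and> L2_norm \<phi> \<le> 1"
    by (rule L2_bounded_imp_square_integrable_density)
qed

end
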